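(* Let $\rho:\mathbb{Z}^p\times\mathbb{R}^q\to\mathrm{Diff}[[\mathbb{C}^n,0]]$ be a homomorphism of Lie groups. Then there exists an abelian linear algebraic group $G$ over $\mathbb{C}$ (in particular an abelian Lie group with finitely many connected components) and a homomorphism of Lie groups $\rho^*:G\to\mathrm{Diff}[[\mathbb{C}^n,0]]$ such that $\operatorname{Im}\rho\subset\operatorname{Im}\rho^*$.
   Context: $\mathrm{Diff}[[\mathbb{C}^n,0]]$ is the group of $\mathbb{C}$-algebra automorphisms of $\mathbb{C}[[x_1,\dots,x_n]]$ preserving the maximal ideal $\mathfrak m$. A map from a Lie group into $\mathrm{Diff}[[\mathbb{C}^n,0]]$ is called a homomorphism of Lie groups if for every $p$ the induced map into the finite-dimensional group of automorphisms of $\mathbb{C}[[x]]/\mathfrak m^{p+1}$ is a homomorphism of Lie groups. *)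

theory Defs
  imports Complex_Main "Jordan_Normal_Form.Matrix"
begin

type_synonym 'n fps_n = "('n \<Rightarrow> nat) \<Rightarrow> complex"

definition fps_n_mult :: "'n::finite fps_n \<Rightarrow> 'n fps_n \<Rightarrow> 'n fps_n" where
  "fps_n_mult f g = (\<lambda>\<alpha>. \<Sum>\<beta>\<in>{\<beta>. \<forall>i. \<beta> i \<le> \<alpha> i}. f \<beta> * g (\<lambda>i. \<alpha> i - \<beta> i))"

definition fps_n_one :: "'n::finite fps_n" where
  "fps_n_one = (\<lambda>\<alpha>. if \<alpha> = (\<lambda>_. 0) then 1 else 0)"

definition fps_n_monom :: "('n::finite \<Rightarrow> nat) \<Rightarrow> 'n fps_n" where
  "fps_n_monom \<beta> = (\<lambda>\<gamma>. if \<gamma> = \<beta> then 1 else 0)"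

definition fps_n_max_ideal :: "'n::finite fps_n set" where
  "fps_n_max_ideal = {f. f (\<lambda>_. 0) = 0}"

definition formal_diff :: "('n::finite fps_n \<Rightarrow> 'n fps_n) set" where
  "formal_diff = {\<phi>. bij \<phi>
     \<and> (\<forall>f g. \<phi> (\<lambda>\<alpha>. f \<alpha> + g \<alpha>) = (\<lambda>\<alpha>. \<phi> f \<alpha> + \<phi> g \<alpha>))
     \<and> (\<forall>c f. \<phi> (\<lambda>\<alpha>. c * f \<alpha>) = (\<lambda>\<alpha>. c * \<phi> f \<alpha>))
     \<and> (\<forall>f g. \<phi> (fps_n_mult f g) = fps_n_mult (\<phi> f) (\<phi> g))
     \<and> \<phi> fps_n_one = fps_n_one
     \<and> \<phi> ` fps_n_max_ideal \<subseteq> fps_n_max_ideal}"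

text \<open>The p-jet of phi (induced automorphism of C[[x]]/m^(k+1)) is the linear map whose
  matrix entries are the coefficients of index alpha, |alpha| <= k, of phi(x^beta), |beta| <= k.\<close>
definition jet_entry :: "('n::finite fps_n \<Rightarrow> 'n fps_n) \<Rightarrow> ('n \<Rightarrow> nat) \<Rightarrow> ('n \<Rightarrow> nat) \<Rightarrow> complex" where
  "jet_entry \<phi> \<alpha> \<beta> = \<phi> (fps_n_monom \<beta>) \<alpha>"

definition ZR_dom :: "nat \<Rightarrow> nat \<Rightarrow> ((nat \<Rightarrow> int) \<times> (nat \<Rightarrow> real)) set" where
  "ZR_dom p q = {(a, b). (\<forall>i\<ge>p. a i = 0) \<and> (\<forall>j\<ge>q. b j = 0)}"

definition ZR_add :: "(nat \<Rightarrow> int) \<times> (nat \<Rightarrow> real) \<Rightarrow> (nat \<Rightarrow> int) \<times> (nat \<Rightarrow> real) \<Rightarrow> (nat \<Rightarrow> int) \<times> (nat \<Rightarrow> real)" where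
  "ZR_add x y = ((\<lambda>i. fst x i + fst y i), (\<lambda>j. snd x j + snd y j))"

definition ZR_continuous :: "nat \<Rightarrow> nat \<Rightarrow> ((nat \<Rightarrow> int) \<times> (nat \<Rightarrow> real) \<Rightarrow> complex) \<Rightarrow> bool" where
  "ZR_continuous p q F = (\<forall>x\<in>ZR_dom p q. \<forall>\<epsilon>>0. \<exists>\<delta>>0. \<forall>y\<in>ZR_dom p q.
     fst y = fst x \<and> (\<forall>j<q. \<bar>snd y j - snd x j\<bar> < \<delta>) \<longrightarrow> cmod (F y - F x) < \<epsilon>)"

definition lie_hom_ZR :: "nat \<Rightarrow> nat \<Rightarrow> ((nat \<Rightarrow> int) \<times> (nat \<Rightarrow> real) \<Rightarrow> ('n::finite fps_n \<Rightarrow> 'n fps_n)) \<Rightarrow> bool" where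
  "lie_hom_ZR p q \<rho> = (\<rho> ` ZR_dom p q \<subseteq> formal_diff
     \<and> (\<forall>x\<in>ZR_dom p q. \<forall>y\<in>ZR_dom p q. \<rho> (ZR_add x y) = \<rho> x \<circ> \<rho> y)
     \<and> (\<forall>k \<alpha> \<beta>. sum \<alpha> UNIV \<le> k \<and> sum \<beta> UNIV \<le> k \<longrightarrow>
          ZR_continuous p q (\<lambda>x. jet_entry (\<rho> x) \<alpha> \<beta>)))"

inductive_set polyfun :: "nat \<Rightarrow> (complex mat \<Rightarrow> complex) set" for N where
  const: "(\<lambda>A. c) \<in> polyfun N"
| entry: "i < N \<Longrightarrow> j < N \<Longrightarrow> (\<lambda>A. A $$ (i, j)) \<in> polyfun N"
| add: "P \<in> polyfun N \<Longrightarrow> Q \<in> polyfun N \<Longrightarrow> (\<lambda>A. P A + Q A) \<in> polyfun N"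
| mult: "P \<in> polyfun N \<Longrightarrow> Q \<in> polyfun N \<Longrightarrow> (\<lambda>A. P A * Q A) \<in> polyfun N"

definition abelian_linear_algebraic_group :: "nat \<Rightarrow> complex mat set \<Rightarrow> bool" where
  "abelian_linear_algebraic_group N G = (
     G \<subseteq> carrier_mat N N \<and> (\<forall>A\<in>G. invertible_mat A)
     \<and> 1\<^sub>m N \<in> G
     \<and> (\<forall>A\<in>G. \<forall>B\<in>G. A * B \<in> G)
     \<and> (\<forall>A\<in>G. \<exists>B\<in>G. A * B = 1\<^sub>m N)
     \<and> (\<forall>A\<in>G. \<forall>B\<in>G. A * B = B * A)
     \<and> (\<exists>S \<subseteq> polyfun N. G = {A \<in> carrier_mat N N. invertible_mat A \<and> (\<forall>P\<in>S. P A = 0)}))"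

definition mat_continuous_on :: "nat \<Rightarrow> complex mat set \<Rightarrow> (complex mat \<Rightarrow> complex) \<Rightarrow> bool" where
  "mat_continuous_on N G F = (\<forall>A\<in>G. \<forall>\<epsilon>>0. \<exists>\<delta>>0. \<forall>B\<in>G.
     (\<forall>i<N. \<forall>j<N. cmod (B $$ (i, j) - A $$ (i, j)) < \<delta>) \<longrightarrow> cmod (F B - F A) < \<epsilon>)"

definition lie_hom_mat :: "nat \<Rightarrow> complex mat set \<Rightarrow> (complex mat \<Rightarrow> ('n::finite fps_n \<Rightarrow> 'n fps_n)) \<Rightarrow> bool" where
  "lie_hom_mat N G \<rho> = (\<rho> ` G \<subseteq> formal_diff
     \<and> (\<forall>A\<in>G. \<forall>B\<in>G. \<rho> (A * B) = \<rho> A \<circ> \<rho> B)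
     \<and> (\<forall>k \<alpha> \<beta>. sum \<alpha> UNIV \<le> k \<and> sum \<beta> UNIV \<le> k \<longrightarrow>
          mat_continuous_on N G (\<lambda>A. jet_entry (\<rho> A) \<alpha> \<beta>)))"

end

theory Submission
  imports Defs "HOL-Library.Function_Algebras" "HOL-Computational_Algebra.Fundamental_Theorem_Algebra"
begin

text \<open>
  The factor \<open>\<real>\<^sup>q\<close> is harmless: it is the image of the algebraic group \<open>\<complex>\<^sup>q\<close> under the real part.
  For the image \<open>F\<close> of a generator of \<open>\<int>\<^sup>p\<close> one uses its Jordan decomposition.  Each jet space splits
  into generalised eigenspaces of \<open>F\<close>, multiplication of power series multiplies eigenvalues, and so
  all eigenvalues lie in the multiplicative monoid \<open>E\<close> generated by the finitely many eigenvalues on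
  \<open>\<mm>/\<mm>\<^sup>2\<close>.  Letting a character \<open>\<chi>\<close> of \<open>E\<close> act as \<open>\<chi>(\<mu>)\<close> on the \<open>\<mu>\<close>-part defines an action of the
  diagonalisable group of characters by automorphisms.  The semisimple part of \<open>F\<close> is the character
  \<open>\<mu> \<mapsto> \<mu>\<close>; the unipotent part \<open>U\<close> lies on the one-parameter group \<open>U\<^sup>z\<close> given by the binomial series.
  Both actions commute with everything that commutes with \<open>F\<close>, so the groups of the individual
  generators and \<open>\<complex>\<^sup>q\<close> combine to an action of their product.
\<close>

section \<open>Power series and filtered operators\<close>

text \<open>The difficulty is that one finite-dimensional group must act on all jet orders at once.
  Zariski closures of the image could be taken in each jet group, but the eigenvalues may become
  more numerous with the order and the closures only form a projective system. Finite generation of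
  \<open>E\<close> caps the torus: a character is known from its values on the generators. These
  values are not free, since coincidences between different monomials in the eigenvalues
  (resonances) must be respected; so the group is cut out of the torus by binomial equations. On the
  unipotent side the binomial series reaches the one-parameter group without passing through a
  logarithm, and reduces every identity to natural powers of \<open>U\<close>. On each jet space
  both parts are polynomials in \<open>F\<close>; this is why they commute with whatever commutes
  with \<open>F\<close>, and several generators can be treated one at a time. The real part is a
  continuous homomorphism of real Lie groups, in line with the continuity demanded by
  \<open>lie_hom_mat\<close>.\<close>

text \<open>As default simplification rules these four expand sums and differences of functions that
  are not applied to an argument.\<close>

lemmas pointwise = plus_fun_apply zero_fun_apply minus_apply uminus_apply
declare pointwise [simp del]

definition mdeg :: "('n::finite \<Rightarrow> nat) \<Rightarrow> nat" where
  "mdeg \<alpha> = sum \<alpha> UNIV"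

definition scale :: "complex \<Rightarrow> 'n fps_n \<Rightarrow> 'n fps_n" where
  "scale c f = (\<lambda>\<alpha>. c * f \<alpha>)"

lemma scale_apply: "scale c f \<alpha> = c * f \<alpha>"
  by (simp add: scale_def)

lemma sum_fps_n_apply: "(\<Sum>i\<in>I. f i) (\<alpha>::'n \<Rightarrow> nat) = (\<Sum>i\<in>I. (f i \<alpha> :: complex))"
  by (induction I rule: infinite_finite_induct) (auto simp: pointwise)

lemma scale_add: "scale c (f + g) = scale c f + scale c g"
  and scale_add_left: "scale (c + d) f = scale c f + scale d f"
  and scale_scale [simp]: "scale c (scale d f) = scale (c * d) f"
  and scale_one [simp]: "scale 1 f = f"
  and scale_zero [simp]: "scale 0 f = 0"
  and scale_zero_right [simp]: "scale c 0 = 0"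
  and scale_diff: "scale c (f - g) = scale c f - scale c g"
  and scale_diff_left: "scale (c - d) f = scale c f - scale d f"
  and scale_minus_left: "scale (- c) f = - scale c f"
  by (auto simp: scale_def fun_eq_iff algebra_simps pointwise)

lemma scale_sum: "scale c (\<Sum>i\<in>I. f i) = (\<Sum>i\<in>I. scale c (f i))"
  by (induction I rule: infinite_finite_induct) (auto simp: scale_add)

lemma scale_sum_left: "scale (\<Sum>i\<in>I. c i) f = (\<Sum>i\<in>I. scale (c i) f)"
  by (induction I rule: infinite_finite_induct) (auto simp: scale_add_left)

section \<open>The m-adic filtration\<close>

definition mpow :: "nat \<Rightarrow> 'n::finite fps_n set" where
  "mpow k = {f. \<forall>\<alpha>. mdeg \<alpha> < k \<longrightarrow> f \<alpha> = 0}"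

lemma mpow_add: "f \<in> mpow k \<Longrightarrow> g \<in> mpow k \<Longrightarrow> f + g \<in> mpow k"
  and mpow_diff: "f \<in> mpow k \<Longrightarrow> g \<in> mpow k \<Longrightarrow> f - g \<in> mpow k"
  and mpow_scale: "f \<in> mpow k \<Longrightarrow> scale c f \<in> mpow k"
  and mpow_zero [simp]: "0 \<in> mpow k"
  by (auto simp: mpow_def scale_def pointwise)

lemma mpow_sum: "(\<And>i. i \<in> I \<Longrightarrow> f i \<in> mpow k) \<Longrightarrow> (\<Sum>i\<in>I. f i) \<in> mpow k"
  by (induction I rule: infinite_finite_induct) (auto intro: mpow_add)

lemma mpow_anti: "j \<le> k \<Longrightarrow> f \<in> mpow k \<Longrightarrow> f \<in> mpow j"
  by (auto simp: mpow_def)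

lemma mpow_0 [simp]: "f \<in> mpow 0"
  by (auto simp: mpow_def)

lemma mdeg_eq_0_iff: "mdeg \<alpha> = 0 \<longleftrightarrow> \<alpha> = (\<lambda>_. 0)"
  by (auto simp: mdeg_def)

lemma fps_n_max_ideal_eq_mpow: "fps_n_max_ideal = mpow (Suc 0)"
  using mdeg_eq_0_iff by (auto simp: fps_n_max_ideal_def mpow_def)

text \<open>Membership \<open>f - g \<in> mpow (Suc k)\<close> plays the role of equality in
  C[[x]]/m^(k+1); working with congruences avoids quotient spaces that change with k.\<close>

lemma mpow_cong_trans: "f - g \<in> mpow k \<Longrightarrow> g - h \<in> mpow k \<Longrightarrow> f - h \<in> mpow k"
  using mpow_add[of "f - g" k "g - h"] by simp

lemma mpow_cong_sym: "f - g \<in> mpow k \<Longrightarrow> g - f \<in> mpow k"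
  using mpow_diff[of 0 k "f - g"] by simp

lemma mpow_cong_common: "f - g \<in> mpow k \<Longrightarrow> h - g \<in> mpow k \<Longrightarrow> f - h \<in> mpow k"
  using mpow_diff[of "f - g" k "h - g"] by simp

lemma mpow_cong_mem: "f - g \<in> mpow k \<Longrightarrow> g \<in> mpow k \<Longrightarrow> f \<in> mpow k"
  using mpow_add[of "f - g" k g] by simp

text \<open>The filtration is separated. Identities between operators defined as limits over jets
  are therefore checked one jet order at a time.\<close>

lemma fps_n_eqI_mpow:
  assumes "\<And>k. f - g \<in> mpow (Suc k)" shows "f = g"
proof
  fix \<alpha>
  from assms[of "mdeg \<alpha>"] show "f \<alpha> = g \<alpha>" by (auto simp: mpow_def pointwise)
qed

lemma finite_index_le: "finite {\<beta>::'n::finite \<Rightarrow> nat. \<forall>i. \<beta> i \<le> \<alpha> i}"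
proof -
  have "{\<beta>::'n \<Rightarrow> nat. \<forall>i. \<beta> i \<le> \<alpha> i} = Pi\<^sub>E UNIV (\<lambda>i. {..\<alpha> i})"
    by (auto simp: PiE_def Pi_def)
  then show ?thesis by (simp add: finite_PiE)
qed

lemma index_le_mdeg: "\<beta> i \<le> mdeg \<beta>"
  unfolding mdeg_def by (rule member_le_sum) auto

lemma finite_mdeg_le: "finite {\<beta>::'n::finite \<Rightarrow> nat. mdeg \<beta> \<le> k}"
  by (rule finite_subset[OF _ finite_index_le[of "\<lambda>_. k"]])
     (auto intro: order_trans[OF index_le_mdeg])

lemma fps_n_mult_add_left: "fps_n_mult (f + g) h = fps_n_mult f h + fps_n_mult g h"
  and fps_n_mult_add_right: "fps_n_mult h (f + g) = fps_n_mult h f + fps_n_mult h g"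
  and fps_n_mult_scale_left: "fps_n_mult (scale c f) h = scale c (fps_n_mult f h)"
  and fps_n_mult_scale_right: "fps_n_mult h (scale c f) = scale c (fps_n_mult h f)"
  by (auto simp: fps_n_mult_def scale_def fun_eq_iff algebra_simps pointwise sum.distrib sum_distrib_left)

lemma fps_n_mult_zero_left [simp]: "fps_n_mult 0 h = 0"
  and fps_n_mult_zero_right [simp]: "fps_n_mult h 0 = 0"
  by (auto simp: fps_n_mult_def fun_eq_iff pointwise)

lemma fps_n_mult_diff_left: "fps_n_mult (f - g) h = fps_n_mult f h - fps_n_mult g h"
  and fps_n_mult_diff_right: "fps_n_mult h (f - g) = fps_n_mult h f - fps_n_mult h g"
  by (auto simp: fps_n_mult_def fun_eq_iff algebra_simps pointwise sum_subtractf)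

lemma fps_n_mult_sum_left: "fps_n_mult (\<Sum>i\<in>I. f i) h = (\<Sum>i\<in>I. fps_n_mult (f i) h)"
  by (induction I rule: infinite_finite_induct) (auto simp: fps_n_mult_add_left)

lemma fps_n_mult_sum_right: "fps_n_mult h (\<Sum>i\<in>I. f i) = (\<Sum>i\<in>I. fps_n_mult h (f i))"
  by (induction I rule: infinite_finite_induct) (auto simp: fps_n_mult_add_right)

lemma mpow_mult:
  assumes "f \<in> mpow a" "g \<in> mpow b"
  shows "fps_n_mult f g \<in> mpow (a + b)"
proof -
  have "f \<beta> * g (\<lambda>i. \<alpha> i - \<beta> i) = 0"
    if "mdeg \<alpha> < a + b" "\<forall>i. \<beta> i \<le> \<alpha> i" for \<alpha> \<beta>
  proof -
    have "mdeg \<beta> + mdeg (\<lambda>i. \<alpha> i - \<beta> i) = mdeg \<alpha>"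
      unfolding mdeg_def using that(2) by (simp flip: sum.distrib)
    then have "mdeg \<beta> < a \<or> mdeg (\<lambda>i. \<alpha> i - \<beta> i) < b"
      using that(1) by linarith
    then show ?thesis using assms by (auto simp: mpow_def)
  qed
  then show ?thesis unfolding mpow_def fps_n_mult_def by (auto intro!: sum.neutral)
qed

lemma mpow_mult_cong:
  assumes "f - f' \<in> mpow k" "g - g' \<in> mpow k"
  shows "fps_n_mult f g - fps_n_mult f' g' \<in> mpow k"
proof -
  have "fps_n_mult f g - fps_n_mult f' g' = fps_n_mult (f - f') g + fps_n_mult f' (g - g')"
    by (simp add: fps_n_mult_diff_left fps_n_mult_diff_right)
  moreover have "fps_n_mult (f - f') g \<in> mpow k" "fps_n_mult f' (g - g') \<in> mpow k"
    using mpow_mult[of "f - f'" k g 0] mpow_mult[of f' 0 "g - g'" k] assms by auto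
  ultimately show ?thesis by (simp add: mpow_add)
qed

definition fps_n_var :: "'n::finite \<Rightarrow> 'n fps_n" where
  "fps_n_var i = fps_n_monom (\<lambda>j. if j = i then 1 else 0)"

lemma fps_n_var_mult:
  "fps_n_mult (fps_n_var i) g \<alpha> = (if 0 < \<alpha> i then g (\<alpha>(i := \<alpha> i - 1)) else 0)"
proof -
  define e where "e = (\<lambda>j. if j = i then 1 else (0::nat))"
  have "fps_n_mult (fps_n_var i) g \<alpha> =
      (\<Sum>\<beta>\<in>{\<beta>. \<forall>i. \<beta> i \<le> \<alpha> i}. if \<beta> = e then g (\<lambda>i. \<alpha> i - e i) else 0)"
    unfolding fps_n_mult_def fps_n_var_def fps_n_monom_def e_def
    by (rule sum.cong) auto
  also have "\<dots> = (if \<forall>j. e j \<le> \<alpha> j then g (\<lambda>i. \<alpha> i - e i) else 0)"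
    using finite_index_le[of \<alpha>] by (simp add: sum.delta)
  also have "(\<forall>j. e j \<le> \<alpha> j) = (0 < \<alpha> i)" by (auto simp: e_def Suc_le_eq)
  also have "(\<lambda>i. \<alpha> i - e i) = \<alpha>(i := \<alpha> i - 1)" by (auto simp: e_def)
  finally show ?thesis .
qed

lemma fps_n_var_mpow: "fps_n_var i \<in> mpow (Suc 0)"
  by (auto simp: mpow_def fps_n_var_def fps_n_monom_def mdeg_eq_0_iff dest: fun_cong[of _ _ i])

text \<open>This presents m^(k+1) as the sum of the x_i m^k, so that statements about m and m^k pass
  to m^(k+1) by multiplicativity.\<close>

lemma mpow_Suc_decompose:
  fixes f :: "'n::finite fps_n"
  assumes "f \<in> mpow (Suc k)"
  obtains g where "\<And>i. g i \<in> mpow k" "f = (\<Sum>i\<in>UNIV. fps_n_mult (fps_n_var i) (g i))"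
proof -
  \<comment> \<open>Each nonconstant monomial is assigned to one variable dividing it, so that the
    sum over \<open>i\<close> counts it exactly once.\<close>
  define c where "c = (\<lambda>\<alpha>::'n \<Rightarrow> nat. SOME l. 0 < \<alpha> l)"
  have c: "0 < \<alpha> (c \<alpha>)" if "\<alpha> \<noteq> (\<lambda>_. 0)" for \<alpha>
    unfolding c_def by (rule someI_ex) (use that in auto)
  define g where "g = (\<lambda>i \<alpha>. if c (\<alpha>(i := Suc (\<alpha> i))) = i then f (\<alpha>(i := Suc (\<alpha> i))) else 0)"
  have deg: "mdeg (\<alpha>(i := Suc (\<alpha> i))) = Suc (mdeg \<alpha>)" for \<alpha> and i :: 'n
  proof -
    have "sum (\<alpha>(i := Suc (\<alpha> i))) (UNIV - {i}) = sum \<alpha> (UNIV - {i})" by (rule sum.cong) auto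
    then show ?thesis by (simp add: mdeg_def sum.remove[of UNIV i])
  qed
  have "g i \<in> mpow k" for i
    using assms deg[of _ i] by (auto simp: mpow_def g_def)
  moreover have "f = (\<Sum>i\<in>UNIV. fps_n_mult (fps_n_var i) (g i))"
  proof
    fix \<alpha> :: "'n \<Rightarrow> nat"
    have "(\<Sum>i\<in>UNIV. fps_n_mult (fps_n_var i) (g i)) \<alpha> =
        (\<Sum>i\<in>UNIV. if c \<alpha> = i then (if 0 < \<alpha> i then f \<alpha> else 0) else 0)"
      unfolding sum_fps_n_apply fps_n_var_mult by (rule sum.cong) (auto simp: g_def)
    also have "\<dots> = (if 0 < \<alpha> (c \<alpha>) then f \<alpha> else 0)" by (simp add: sum.delta)
    also have "\<dots> = f \<alpha>"
    proof (cases "\<alpha> = (\<lambda>_. 0)")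
      case True
      then have "mdeg \<alpha> < Suc k" using mdeg_eq_0_iff[of \<alpha>] by simp
      with assms have "f \<alpha> = 0" by (auto simp: mpow_def)
      then show ?thesis by simp
    qed (use c in auto)
    finally show "f \<alpha> = (\<Sum>i\<in>UNIV. fps_n_mult (fps_n_var i) (g i)) \<alpha>" ..
  qed
  ultimately show ?thesis using that by blast
qed

section \<open>Linear operators compatible with the filtration\<close>

definition lin :: "('n fps_n \<Rightarrow> 'n fps_n) \<Rightarrow> bool" where
  "lin \<phi> \<longleftrightarrow> (\<forall>f g. \<phi> (f + g) = \<phi> f + \<phi> g) \<and> (\<forall>c f. \<phi> (scale c f) = scale c (\<phi> f))"

lemma lin_add: "lin \<phi> \<Longrightarrow> \<phi> (f + g) = \<phi> f + \<phi> g"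
  and lin_scale: "lin \<phi> \<Longrightarrow> \<phi> (scale c f) = scale c (\<phi> f)"
  by (auto simp: lin_def)

lemma lin_zero: "lin \<phi> \<Longrightarrow> \<phi> 0 = 0"
  using lin_scale[of \<phi> 0 0] by simp

lemma lin_diff: "lin \<phi> \<Longrightarrow> \<phi> (f - g) = \<phi> f - \<phi> g"
  using lin_add[of \<phi> f "scale (- 1) g"] lin_scale[of \<phi> "- 1" g] by (simp add: scale_minus_left)

lemma lin_sum: "lin \<phi> \<Longrightarrow> \<phi> (\<Sum>i\<in>I. f i) = (\<Sum>i\<in>I. \<phi> (f i))"
  by (induction I rule: infinite_finite_induct) (auto simp: lin_add lin_zero)

text \<open>These are the linear maps that induce maps on every jet space. Multiplicativity is left
  out so that polynomials in an automorphism qualify.\<close>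

definition filtered :: "('n::finite fps_n \<Rightarrow> 'n fps_n) \<Rightarrow> bool" where
  "filtered \<phi> \<longleftrightarrow> lin \<phi> \<and> (\<forall>k. \<forall>f\<in>mpow k. \<phi> f \<in> mpow k)"

lemma filtered_lin: "filtered \<phi> \<Longrightarrow> lin \<phi>"
  and filtered_mpow: "filtered \<phi> \<Longrightarrow> f \<in> mpow k \<Longrightarrow> \<phi> f \<in> mpow k"
  by (auto simp: filtered_def)

lemma filtered_cong: "filtered \<phi> \<Longrightarrow> f - g \<in> mpow k \<Longrightarrow> \<phi> f - \<phi> g \<in> mpow k"
  using filtered_mpow[of \<phi> "f - g" k] by (simp add: lin_diff filtered_lin)

lemma filtered_id: "filtered id" "filtered (\<lambda>f. f)"
  by (auto simp: filtered_def lin_def)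

lemma filtered_comp: "filtered \<phi> \<Longrightarrow> filtered \<psi> \<Longrightarrow> filtered (\<phi> \<circ> \<psi>)"
  by (auto simp: filtered_def lin_def)

lemma filtered_scale: "filtered \<phi> \<Longrightarrow> filtered (\<lambda>f. scale c (\<phi> f))"
  by (auto simp: filtered_def lin_def scale_add mult.commute intro: mpow_scale)

lemma filtered_add: "filtered \<phi> \<Longrightarrow> filtered \<psi> \<Longrightarrow> filtered (\<lambda>f. \<phi> f + \<psi> f)"
  by (auto simp: filtered_def lin_def scale_add intro: mpow_add)

lemma filtered_diff: "filtered \<phi> \<Longrightarrow> filtered \<psi> \<Longrightarrow> filtered (\<lambda>f. \<phi> f - \<psi> f)"
  by (auto simp: filtered_def lin_def scale_diff intro: mpow_diff)

lemma filtered_zero: "filtered (\<lambda>f. 0)"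
  by (auto simp: filtered_def lin_def)

lemma filtered_sum: "(\<And>i. i \<in> I \<Longrightarrow> filtered (\<phi> i)) \<Longrightarrow> filtered (\<lambda>f. \<Sum>i\<in>I. \<phi> i f)"
  by (induction I rule: infinite_finite_induct) (auto intro: filtered_add filtered_zero)

lemma filtered_funpow: "filtered \<phi> \<Longrightarrow> filtered (\<phi> ^^ j)"
  by (induction j) (auto intro: filtered_id filtered_comp)

lemma fps_n_expand:
  "f - (\<Sum>\<beta> | mdeg \<beta> \<le> k. scale (f \<beta>) (fps_n_monom \<beta>)) \<in> mpow (Suc k)"
proof -
  have "(\<Sum>\<beta> | mdeg \<beta> \<le> k. f \<beta> * fps_n_monom \<beta> \<alpha>) = f \<alpha>" if "mdeg \<alpha> \<le> k" for \<alpha>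
  proof -
    have "(\<Sum>\<beta> | mdeg \<beta> \<le> k. f \<beta> * fps_n_monom \<beta> \<alpha>) =
        (\<Sum>\<beta> | mdeg \<beta> \<le> k. if \<beta> = \<alpha> then f \<beta> else 0)"
      by (rule sum.cong) (auto simp: fps_n_monom_def)
    then show ?thesis using that by (simp add: sum.delta finite_mdeg_le)
  qed
  then show ?thesis by (simp add: mpow_def sum_fps_n_apply scale_apply pointwise)
qed

text \<open>The tail of \<open>f\<close> beyond degree |\<alpha>| is sent into m^(|\<alpha>|+1) and
  cannot reach the coefficient at \<alpha>. Continuity and polynomial dependence on parameters
  thereby become questions about finite sums.\<close>

lemma filtered_apply_eq:
  assumes "filtered \<phi>"
  shows "\<phi> f \<alpha> = (\<Sum>\<beta> | mdeg \<beta> \<le> mdeg \<alpha>. f \<beta> * jet_entry \<phi> \<alpha> \<beta>)"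
proof -
  have "\<phi> f - \<phi> (\<Sum>\<beta> | mdeg \<beta> \<le> mdeg \<alpha>. scale (f \<beta>) (fps_n_monom \<beta>)) \<in> mpow (Suc (mdeg \<alpha>))"
    by (rule filtered_cong[OF assms fps_n_expand])
  then have "\<phi> f \<alpha> = \<phi> (\<Sum>\<beta> | mdeg \<beta> \<le> mdeg \<alpha>. scale (f \<beta>) (fps_n_monom \<beta>)) \<alpha>"
    by (auto simp: mpow_def pointwise)
  then show ?thesis
    by (simp add: lin_sum lin_scale filtered_lin[OF assms] sum_fps_n_apply scale_apply jet_entry_def)
qed

section \<open>Formal diffeomorphisms and the filtration\<close>

lemma formal_diff_iff:
  "\<phi> \<in> formal_diff \<longleftrightarrow> bij \<phi> \<and> lin \<phi> \<and> (\<forall>f g. \<phi> (fps_n_mult f g) = fps_n_mult (\<phi> f) (\<phi> g))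
     \<and> \<phi> fps_n_one = fps_n_one \<and> (\<forall>f\<in>mpow (Suc 0). \<phi> f \<in> mpow (Suc 0))"
  unfolding formal_diff_def lin_def scale_def plus_fun_def fps_n_max_ideal_eq_mpow by auto

text \<open>Only m is known to be preserved; multiplicativity carries this to its powers through the
  decomposition into x_i m^k.\<close>

lemma formal_diff_filtered:
  assumes "\<phi> \<in> formal_diff" shows "filtered \<phi>"
proof -
  have "\<forall>f\<in>mpow k. \<phi> f \<in> mpow k" for k
  proof (induction k)
    case (Suc k)
    show ?case
    proof
      fix f :: "'a fps_n" assume "f \<in> mpow (Suc k)"
      then obtain g where g: "\<And>i. g i \<in> mpow k" "f = (\<Sum>i\<in>UNIV. fps_n_mult (fps_n_var i) (g i))"
        by (rule mpow_Suc_decompose) blast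
      have "\<phi> f = (\<Sum>i\<in>UNIV. fps_n_mult (\<phi> (fps_n_var i)) (\<phi> (g i)))"
        using assms by (simp add: g(2) lin_sum formal_diff_iff)
      moreover have "fps_n_mult (\<phi> (fps_n_var i)) (\<phi> (g i)) \<in> mpow (Suc k)" for i
        using mpow_mult[of "\<phi> (fps_n_var i)" "Suc 0" "\<phi> (g i)" k] assms Suc.IH g(1)
          fps_n_var_mpow[of i] by (simp add: formal_diff_iff)
      ultimately show "\<phi> f \<in> mpow (Suc k)" by (simp add: mpow_sum)
    qed
  qed auto
  with assms show ?thesis by (auto simp: filtered_def formal_diff_iff)
qed

lemma formal_diff_comp: "\<phi> \<in> formal_diff \<Longrightarrow> \<psi> \<in> formal_diff \<Longrightarrow> \<phi> \<circ> \<psi> \<in> formal_diff"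
  unfolding formal_diff_iff lin_def by (auto intro: bij_comp)

text \<open>The definition gives only one inclusion for m. Since \<phi> fixes constants, a series
  with nonzero constant term cannot be mapped into m; hence the inverse of \<phi> also preserves m,
  is a formal diffeomorphism, and is filtered.\<close>

lemma formal_diff_reflects_mpow:
  fixes f :: "'n::finite fps_n"
  assumes \<phi>: "\<phi> \<in> formal_diff" and "\<phi> f \<in> mpow k" shows "f \<in> mpow k"
proof -
  have bij: "bij \<phi>" and lin: "lin \<phi>" using \<phi> by (auto simp: formal_diff_iff)
  have r1: "g \<in> mpow (Suc 0)" if "\<phi> g \<in> mpow (Suc 0)" for g
  proof -
    define c where "c = g (\<lambda>_. 0)"
    have "g - scale c fps_n_one \<in> mpow (Suc 0)"
      by (auto simp: mpow_def mdeg_eq_0_iff c_def scale_def fps_n_one_def pointwise)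
    then have "\<phi> g - \<phi> (scale c fps_n_one) \<in> mpow (Suc 0)"
      using filtered_cong formal_diff_filtered[OF \<phi>] by blast
    moreover have "\<phi> (scale c fps_n_one) = scale c fps_n_one"
      using \<phi> by (auto simp: formal_diff_iff lin_scale)
    ultimately have "scale c (fps_n_one :: 'n fps_n) \<in> mpow (Suc 0)"
      using that mpow_cong_mem mpow_cong_sym by metis
    then have "c = 0" by (auto simp: mpow_def scale_def fps_n_one_def mdeg_eq_0_iff)
    then show ?thesis by (auto simp: c_def mpow_def mdeg_eq_0_iff)
  qed
  define \<psi> where "\<psi> = inv_into UNIV \<phi>"
  have inv: "\<phi> (\<psi> g) = g" "\<psi> (\<phi> g) = g" for g
    using bij by (simp_all add: \<psi>_def surj_f_inv_f bij_is_surj inv_f_f bij_is_inj)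
  have eqI: "\<psi> g = h" if "\<phi> h = g" for g h using inv(2)[of h] that by simp
  have "\<psi> \<in> formal_diff"
    unfolding formal_diff_iff
  proof (intro conjI allI ballI)
    show "bij \<psi>" using bij unfolding \<psi>_def by (rule bij_imp_bij_inv)
    show "lin \<psi>"
      unfolding lin_def by (intro conjI allI eqI) (simp_all add: lin lin_add lin_scale inv)
    show "\<psi> (fps_n_mult g h) = fps_n_mult (\<psi> g) (\<psi> h)" for g h
      using \<phi> by (intro eqI) (simp add: inv formal_diff_iff)
    show "\<psi> fps_n_one = fps_n_one"
      using \<phi> by (intro eqI) (simp add: formal_diff_iff)
    show "\<psi> g \<in> mpow (Suc 0)" if "g \<in> mpow (Suc 0)" for g using that r1 inv by metis
  qed
  then show ?thesis
    using filtered_mpow[OF formal_diff_filtered, of \<psi> "\<phi> f" k] assms(2) inv by metis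
qed

section \<open>Polynomials of an operator\<close>

definition pact :: "('n fps_n \<Rightarrow> 'n fps_n) \<Rightarrow> complex poly \<Rightarrow> 'n fps_n \<Rightarrow> 'n fps_n" where
  "pact F p f = (\<Sum>i\<le>degree p. scale (coeff p i) ((F ^^ i) f))"

lemma pact_eq: "degree p \<le> n \<Longrightarrow> pact F p f = (\<Sum>i\<le>n. scale (coeff p i) ((F ^^ i) f))"
  unfolding pact_def by (rule sum.mono_neutral_left) (auto simp: coeff_eq_0)

lemma pact_0 [simp]: "pact F 0 f = 0"
  by (simp add: pact_def)

lemma pact_1 [simp]: "pact F 1 f = f"
  by (simp add: pact_def)

lemma pact_pCons:
  assumes "lin F"
  shows "pact F (pCons a p) f = scale a f + F (pact F p f)"
proof -
  have "pact F (pCons a p) f = (\<Sum>i\<le>Suc (degree p). scale (coeff (pCons a p) i) ((F ^^ i) f))"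
    by (rule pact_eq) (simp add: degree_pCons_le)
  also have "\<dots> = scale a f + (\<Sum>i\<le>degree p. scale (coeff p i) ((F ^^ Suc i) f))"
    by (simp add: sum.atMost_Suc_shift del: sum.atMost_Suc)
  also have "(\<Sum>i\<le>degree p. scale (coeff p i) ((F ^^ Suc i) f)) = F (pact F p f)"
    unfolding pact_def using assms by (simp add: lin_sum lin_scale)
  finally show ?thesis .
qed

lemma pact_add: "pact F (p + q) f = pact F p f + pact F q f"
proof -
  define n where "n = max (degree p) (degree q)"
  have "degree (p + q) \<le> n" "degree p \<le> n" "degree q \<le> n"
    unfolding n_def by (auto intro: degree_add_le)
  then show ?thesis
    by (simp add: pact_eq[of _ n] scale_add_left sum.distrib)
qed

lemma pact_smult: "pact F (smult c p) f = scale c (pact F p f)"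
  by (simp add: pact_eq[of _ "degree p"] degree_smult_le scale_sum)

lemma pact_sum: "pact F (\<Sum>i\<in>I. p i) f = (\<Sum>i\<in>I. pact F (p i) f)"
  by (induction I rule: infinite_finite_induct) (auto simp: pact_add)

lemma pact_mult:
  assumes "lin F"
  shows "pact F (p * q) f = pact F p (pact F q f)"
  by (induction p) (simp_all add: pact_add pact_smult pact_pCons[OF assms])

lemma pact_commute: "lin F \<Longrightarrow> pact F p (pact F q f) = pact F q (pact F p f)"
  by (metis pact_mult mult.commute)

lemma pact_linear_factor: "lin F \<Longrightarrow> pact F [:- \<mu>, 1:] f = F f - scale \<mu> f"
  by (simp add: pact_pCons lin_zero scale_minus_left)

lemma pact_F: "lin F \<Longrightarrow> pact F p (F f) = F (pact F p f)"
  using pact_commute[of F "[:0, 1:]" p f] by (simp add: pact_pCons lin_zero)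

lemma filtered_pact: "filtered F \<Longrightarrow> filtered (pact F p)"
  unfolding pact_def by (intro filtered_sum filtered_scale filtered_funpow)

lemma pact_mpow: "filtered F \<Longrightarrow> f \<in> mpow k \<Longrightarrow> pact F p f \<in> mpow k"
  using filtered_mpow filtered_pact by blast

lemma pact_dvd_mpow:
  assumes "filtered F" "p dvd q" "pact F p f \<in> mpow k"
  shows "pact F q f \<in> mpow k"
proof -
  obtain r where "q = r * p" using assms(2) by (metis dvdE mult.commute)
  then show ?thesis using assms by (simp add: pact_mult filtered_lin pact_mpow)
qed

lemma pact_intertwine:
  assumes "lin \<psi>" "\<psi> \<circ> F = F \<circ> \<psi>"
  shows "\<psi> (pact F p f) = pact F p (\<psi> f)"
proof -
  have "\<psi> (F g) = F (\<psi> g)" for g using assms(2) by (metis comp_apply)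
  then have "\<psi> ((F ^^ i) f) = (F ^^ i) (\<psi> f)" for i by (induction i) auto
  then show ?thesis unfolding pact_def using assms(1) by (simp add: lin_sum lin_scale)
qed

section \<open>Bezout identities and partial fractions\<close>

lemma bezout_linear_power:
  fixes Q :: "complex poly"
  assumes "poly Q \<mu> \<noteq> 0"
  obtains a b where "a * [:- \<mu>, 1:] ^ r + b * Q = 1"
proof -
  have "\<exists>a b. a * [:- \<mu>, 1:] ^ r + b * Q = 1"
  proof (induction r)
    case 0
    have "1 * [:- \<mu>, 1:] ^ 0 + 0 * Q = 1" by simp
    then show ?case by blast
  next
    case (Suc r)
    then obtain a b where ab: "a * [:- \<mu>, 1:] ^ r + b * Q = 1" by blast
    define c where "c = poly Q \<mu>"
    have "[:- \<mu>, 1:] dvd Q - [:c:]" by (simp add: c_def flip: poly_eq_0_iff_dvd)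
    then obtain S where S: "Q - [:c:] = [:- \<mu>, 1:] * S" by (rule dvdE)
    have c: "c \<noteq> 0" using assms by (simp add: c_def)
    \<comment> \<open>The case of exponent 1: write Q = c + (X - \<mu>) S with c = Q(\<mu>) and
      divide by c. Multiplying this identity with the one for exponent r gives exponent r + 1,
      because all other terms contain Q.\<close>
    define a' b' where "a' = - smult (1 / c) S" and "b' = [:1 / c:]"
    have ab': "a' * [:- \<mu>, 1:] + b' * Q = 1"
    proof -
      have "smult (1 / c) (Q - [:- \<mu>, 1:] * S) = smult (1 / c) [:c:]"
        using S by (metis add_diff_cancel_left' diff_add_cancel)
      also have "\<dots> = 1" using c by (simp add: one_pCons)
      finally have "smult (1 / c) (Q - [:- \<mu>, 1:] * S) = 1" .
      moreover have "- smult (1 / c) S * L + [:1 / c:] * Q = smult (1 / c) (Q - L * S)" for L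
        by (simp add: smult_diff_right mult.commute)
      ultimately show ?thesis unfolding a'_def b'_def by (simp only:)
    qed
    have expand: "(a * X + b * Q) * (a' * L + b' * Q) =
        a * a' * (L * X) + (a * X * b' + b * (a' * L + b' * Q)) * Q" for X L
      by (simp add: algebra_simps)
    have "1 = (a * [:- \<mu>, 1:] ^ r + b * Q) * (a' * [:- \<mu>, 1:] + b' * Q)"
      by (simp only: ab ab' mult_1)
    also have "\<dots> = (a * a') * [:- \<mu>, 1:] ^ Suc r
        + (a * [:- \<mu>, 1:] ^ r * b' + b * (a' * [:- \<mu>, 1:] + b' * Q)) * Q"
      unfolding power_Suc by (rule expand)
    finally show ?case by metis
  qed
  then show ?thesis using that by blast
qed

text \<open>The \<open>e \<mu>\<close> are, modulo Q, the projections of C[X]/(Q) onto its primary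
  components. The induction splits off the full power of X - \<mu> dividing Q, which leaves a
  coprime cofactor of smaller degree.\<close>

lemma partial_fractions:
  fixes Q :: "complex poly"
  assumes "Q \<noteq> 0" "\<And>\<mu>. poly Q \<mu> = 0 \<Longrightarrow> \<mu> \<in> E" "E \<noteq> {}"
  obtains R e r where "finite R" "R \<subseteq> E" "(\<Sum>\<mu>\<in>R. e \<mu>) = 1"
    "\<And>\<mu>. \<mu> \<in> R \<Longrightarrow> Q dvd [:- \<mu>, 1:] ^ r \<mu> * e \<mu>"
proof -
  have "\<exists>R e r. finite R \<and> R \<subseteq> {\<mu>. poly Q \<mu> = 0} \<and> (\<Sum>\<mu>\<in>R. e \<mu>) = 1 \<and>
      (\<forall>\<mu>\<in>R. Q dvd [:- \<mu>, 1:] ^ r \<mu> * e \<mu>)" if "Q \<noteq> 0" "\<exists>\<mu>. poly Q \<mu> = 0" for Q :: "complex poly"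
    using that
  proof (induction "degree Q" arbitrary: Q rule: less_induct)
    case less
    obtain \<mu> where \<mu>: "poly Q \<mu> = 0" using less.prems by blast
    define m where "m = order \<mu> Q"
    have "m > 0" using less.prems \<mu> by (simp add: m_def order_gt_0_iff)
    obtain P where P: "Q = [:- \<mu>, 1:] ^ m * P" "\<not> [:- \<mu>, 1:] dvd P"
      using order_decomp[OF less.prems(1), of \<mu>] m_def by blast
    have P\<mu>: "poly P \<mu> \<noteq> 0" using P(2) by (simp add: poly_eq_0_iff_dvd)
    have "P \<noteq> 0" using P\<mu> by auto
    have deg: "degree P < degree Q"
      using \<open>m > 0\<close> \<open>P \<noteq> 0\<close> by (simp add: P(1) degree_mult_eq degree_power_eq)
    obtain a b where ab: "a * [:- \<mu>, 1:] ^ m + b * P = 1"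
      using bezout_linear_power[OF P\<mu>] by blast
    show ?case
    proof (cases "\<exists>\<nu>. poly P \<nu> = 0")
      case False
      then have "constant (poly P)" using fundamental_theorem_of_algebra by blast
      then have "degree P = 0" by (simp add: constant_degree)
      then obtain c where c: "P = [:c:]" by (rule degree_eq_zeroE)
      then have "c \<noteq> 0" using P\<mu> by simp
      have "Q dvd [:- \<mu>, 1:] ^ m * 1"
        using \<open>c \<noteq> 0\<close> by (intro dvdI[of _ _ "[:1 / c:]"]) (simp add: P(1) c)
      then show ?thesis using \<mu>
        by (intro exI[of _ "{\<mu>}"] exI[of _ "\<lambda>_. 1"] exI[of _ "\<lambda>_. m"]) auto
    next
      case True
      from less.hyps[OF deg \<open>P \<noteq> 0\<close> True] obtain R e r where
        R: "finite R" "R \<subseteq> {\<mu>. poly P \<mu> = 0}" "(\<Sum>\<mu>\<in>R. e \<mu>) = 1"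
          "\<forall>\<mu>\<in>R. P dvd [:- \<mu>, 1:] ^ r \<mu> * e \<mu>" by blast
      have "\<mu> \<notin> R" using R(2) P\<mu> by auto
      \<comment> \<open>Replacing the first term of a (X - \<mu>)^m + b P = 1 by its product with
        the decomposition of 1 for P yields the new decomposition of 1.\<close>
      define e' where "e' = (\<lambda>\<nu>. if \<nu> = \<mu> then b * P else a * [:- \<mu>, 1:] ^ m * e \<nu>)"
      define r' where "r' = (\<lambda>\<nu>. if \<nu> = \<mu> then m else r \<nu>)"
      have "(\<Sum>\<nu>\<in>R. e' \<nu>) = (\<Sum>\<nu>\<in>R. a * [:- \<mu>, 1:] ^ m * e \<nu>)"
        using \<open>\<mu> \<notin> R\<close> by (intro sum.cong) (auto simp: e'_def)
      also have "\<dots> = a * [:- \<mu>, 1:] ^ m" using R(3) by (simp flip: sum_distrib_left)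
      finally have s: "(\<Sum>\<nu>\<in>insert \<mu> R. e' \<nu>) = 1"
        using R(1) \<open>\<mu> \<notin> R\<close> ab by (simp add: e'_def add.commute)
      have d: "Q dvd [:- \<nu>, 1:] ^ r' \<nu> * e' \<nu>" if "\<nu> \<in> insert \<mu> R" for \<nu>
      proof (cases "\<nu> = \<mu>")
        case True
        have "[:- \<nu>, 1:] ^ r' \<nu> * e' \<nu> = Q * b"
          by (simp only: True r'_def e'_def P(1) simp_thms if_True mult_ac)
        then show ?thesis by (simp only: dvd_triv_left)
      next
        case False
        with that R(4) have "P dvd [:- \<nu>, 1:] ^ r \<nu> * e \<nu>" by blast
        then obtain s where s: "[:- \<nu>, 1:] ^ r \<nu> * e \<nu> = P * s" by (rule dvdE)
        have "[:- \<nu>, 1:] ^ r' \<nu> * e' \<nu> = a * [:- \<mu>, 1:] ^ m * ([:- \<nu>, 1:] ^ r \<nu> * e \<nu>)"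
          by (simp only: False r'_def e'_def if_False mult_ac)
        also have "\<dots> = Q * (a * s)" unfolding s by (simp only: P(1) mult_ac)
        finally show ?thesis by (simp only: dvd_triv_left)
      qed
      have sub: "insert \<mu> R \<subseteq> {\<mu>. poly Q \<mu> = 0}" using R(2) \<mu> by (auto simp: P(1))
      show ?thesis
        by (intro exI[of _ "insert \<mu> R"] exI[of _ e'] exI[of _ r'] conjI ballI)
          (use R(1) s d sub in blast)+
    qed
  qed
  note main = this
  show ?thesis
  proof (cases "\<exists>\<mu>. poly Q \<mu> = 0")
    case True
    from main[OF assms(1) True] show ?thesis using assms(2) that by blast
  next
    case False
    then have "constant (poly Q)" using fundamental_theorem_of_algebra by blast
    then have "degree Q = 0" by (simp add: constant_degree)
    with assms(1) have "Q dvd 1" by (simp add: is_unit_iff_degree)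
    \<comment> \<open>A constant Q divides everything, so any single element of \<open>E\<close>
      with exponent 0 will do; this is where \<open>E\<close> must be nonempty.\<close>
    moreover obtain \<nu> where "\<nu> \<in> E" using assms(3) by blast
    ultimately show ?thesis using that[of "{\<nu>}" "\<lambda>_. 1" "\<lambda>_. 0"] by simp
  qed
qed

section \<open>Spectral decomposition of a formal diffeomorphism\<close>

text \<open>A twisted Leibniz rule: F(gh) - \<mu>\<nu> gh = (Fg - \<mu> g) Fh + \<mu> g (Fh - \<nu>
  h). Each application lowers r or s by one, until one factor has moved c levels up the filtration.
  The offsets a and b let the same estimate serve jet spaces (a = b = 0) and graded pieces.\<close>

lemma pact_power_mult_mpow:
  assumes F: "F \<in> formal_diff"
    and "g \<in> mpow a" "h \<in> mpow b"
    and "pact F ([:- \<mu>, 1:] ^ r) g \<in> mpow (a + c)" "pact F ([:- \<nu>, 1:] ^ s) h \<in> mpow (b + c)"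
  shows "pact F ([:- (\<mu> * \<nu>), 1:] ^ (r + s)) (fps_n_mult g h) \<in> mpow (a + b + c)"
  using assms(2-)
proof (induction "r + s" arbitrary: r s g h rule: less_induct)
  case less
  have filt: "filtered F" using F by (rule formal_diff_filtered)
  then have lin: "lin F" by (rule filtered_lin)
  show ?case
  proof (cases "r = 0 \<or> s = 0")
    case True
    then have "fps_n_mult g h \<in> mpow (a + b + c)"
    proof
      assume "r = 0"
      then have "fps_n_mult g h \<in> mpow ((a + c) + b)" using less.prems by (intro mpow_mult) auto
      then show ?thesis by (simp add: add_ac)
    next
      assume "s = 0"
      then have "fps_n_mult g h \<in> mpow (a + (b + c))" using less.prems by (intro mpow_mult) auto
      then show ?thesis by (simp add: add_ac)
    qed
    then show ?thesis by (rule pact_mpow[OF filt])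
  next
    case False
    then obtain r' s' where rs: "r = Suc r'" "s = Suc s'" by (metis not0_implies_Suc)
    let ?L = "\<lambda>\<mu>. [:- \<mu>, 1:] :: complex poly"
    let ?m = "r' + s' + 1"
    have step: "pact F (?L (\<mu> * \<nu>)) (fps_n_mult g h) =
        fps_n_mult (pact F (?L \<mu>) g) (F h) + scale \<mu> (fps_n_mult g (pact F (?L \<nu>) h))"
    proof -
      have "F (fps_n_mult g h) = fps_n_mult (F g) (F h)" using F by (simp add: formal_diff_iff)
      then show ?thesis
        by (simp only: pact_linear_factor[OF lin])
          (simp add: fps_n_mult_diff_left fps_n_mult_diff_right fps_n_mult_scale_left
            fps_n_mult_scale_right scale_diff)
    qed
    have c1: "pact F (?L (\<mu> * \<nu>) ^ (r' + s)) (fps_n_mult (pact F (?L \<mu>) g) (F h)) \<in> mpow (a + b + c)"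
    proof (rule less.hyps)
      show "r' + s < r + s" by (simp add: rs)
      show "pact F (?L \<mu>) g \<in> mpow a" "F h \<in> mpow b"
        using less.prems pact_mpow[OF filt] filtered_mpow[OF filt] by blast+
      show "pact F (?L \<mu> ^ r') (pact F (?L \<mu>) g) \<in> mpow (a + c)"
        using less.prems(3) by (simp only: rs power_Suc2 pact_mult[OF lin])
      show "pact F (?L \<nu> ^ s) (F h) \<in> mpow (b + c)"
        using less.prems(4) filtered_mpow[OF filt] by (simp only: pact_F[OF lin])
    qed
    have c2: "pact F (?L (\<mu> * \<nu>) ^ (r + s')) (fps_n_mult g (pact F (?L \<nu>) h)) \<in> mpow (a + b + c)"
    proof (rule less.hyps)
      show "r + s' < r + s" by (simp add: rs)
      show "g \<in> mpow a" "pact F (?L \<nu>) h \<in> mpow b"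
        using less.prems pact_mpow[OF filt] by blast+
      show "pact F (?L \<nu> ^ s') (pact F (?L \<nu>) h) \<in> mpow (b + c)"
        using less.prems(4) by (simp only: rs power_Suc2 pact_mult[OF lin])
      show "pact F (?L \<mu> ^ r) g \<in> mpow (a + c)" by (rule less.prems(3))
    qed
    have e: "r' + s = ?m" "r + s' = ?m" "r + s = Suc ?m" by (auto simp: rs)
    have "pact F (?L (\<mu> * \<nu>) ^ (r + s)) (fps_n_mult g h) =
        pact F (?L (\<mu> * \<nu>) ^ ?m) (pact F (?L (\<mu> * \<nu>)) (fps_n_mult g h))"
      by (simp only: e(3) power_Suc2 pact_mult[OF lin])
    also have "\<dots> = pact F (?L (\<mu> * \<nu>) ^ ?m) (fps_n_mult (pact F (?L \<mu>) g) (F h)) +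
        scale \<mu> (pact F (?L (\<mu> * \<nu>) ^ ?m) (fps_n_mult g (pact F (?L \<nu>) h)))"
      unfolding step using filtered_lin[OF filtered_pact[OF filt]] by (simp only: lin_add lin_scale)
    also have "\<dots> \<in> mpow (a + b + c)"
      using c1 c2 unfolding e by (intro mpow_add mpow_scale)
    finally show ?thesis .
  qed
qed

text \<open>The generalised eigenspaces of \<open>F\<close> on all jet spaces have their eigenvalues in the
  multiplicative monoid \<open>E\<close> as soon as this holds on the cotangent space
  \<open>\<mm>/\<mm>\<^sup>2\<close>, where it is witnessed by the polynomial \<open>q\<close>.\<close>

locale spectral =
  fixes F :: "'n::finite fps_n \<Rightarrow> 'n fps_n" and E :: "complex set" and q :: "complex poly"
  assumes F: "F \<in> formal_diff"
    and E_one: "1 \<in> E" and E_mult: "\<And>\<mu> \<nu>. \<mu> \<in> E \<Longrightarrow> \<nu> \<in> E \<Longrightarrow> \<mu> * \<nu> \<in> E" and E_nonzero: "0 \<notin> E"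
    and q_nonzero: "q \<noteq> 0" and q_roots: "\<And>\<mu>. poly q \<mu> = 0 \<Longrightarrow> \<mu> \<in> E"
    and q_pact: "\<And>f. f \<in> mpow (Suc 0) \<Longrightarrow> pact F q f \<in> mpow (Suc (Suc 0))"
begin

lemma filt: "filtered F"
  using F by (rule formal_diff_filtered)

lemma lin: "lin F"
  using filt by (rule filtered_lin)

text \<open>The exponent is made common to all of \<open>R\<close> by taking the maximum, and the
  bound is kept for every \<open>k\<close> because the annihilator may work on one level of the
  filtration only.\<close>

lemma E_partial_fractions:
  fixes Q :: "complex poly"
  assumes "Q \<noteq> 0" "\<And>\<mu>. poly Q \<mu> = 0 \<Longrightarrow> \<mu> \<in> E"
  obtains R e r where "finite R" "R \<subseteq> E" "\<And>f. f = (\<Sum>\<mu>\<in>R. pact F (e \<mu>) f)"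
    "\<And>\<mu> f k. \<mu> \<in> R \<Longrightarrow> pact F Q f \<in> mpow k \<Longrightarrow> pact F ([:- \<mu>, 1:] ^ r) (pact F (e \<mu>) f) \<in> mpow k"
proof -
  obtain R e r where R: "finite R" "R \<subseteq> E" "(\<Sum>\<mu>\<in>R. e \<mu>) = 1"
    "\<And>\<mu>. \<mu> \<in> R \<Longrightarrow> Q dvd [:- \<mu>, 1:] ^ r \<mu> * e \<mu>"
    using partial_fractions[OF assms] E_one by blast
  define m where "m = Max (r ` R)"
  have "pact F ([:- \<mu>, 1:] ^ m) (pact F (e \<mu>) f) \<in> mpow k"
    if "\<mu> \<in> R" "pact F Q f \<in> mpow k" for \<mu> f k
  proof -
    have "r \<mu> \<le> m" using R(1) that by (simp add: m_def)
    then have "[:- \<mu>, 1:] ^ r \<mu> * e \<mu> dvd [:- \<mu>, 1:] ^ m * e \<mu>"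
      by (intro mult_dvd_mono le_imp_power_dvd) auto
    then have "Q dvd [:- \<mu>, 1:] ^ m * e \<mu>" using R(4)[OF that(1)] dvd_trans by blast
    then show ?thesis
      using pact_dvd_mpow[OF filt _ that(2)] by (simp only: pact_mult[OF lin, symmetric])
  qed
  moreover have "f = (\<Sum>\<mu>\<in>R. pact F (e \<mu>) f)" for f
    using R(3) pact_sum[of F e R f] by simp
  ultimately show ?thesis using R(1,2) that[of R e m] by blast
qed

text \<open>The piece m^(j+2)/m^(j+3) is spanned by products from m/m^2 and m^(j+1)/m^(j+2), so its
  eigenvalues are products of theirs and stay in the monoid. For k = 0 the piece consists of the
  constants, on which \<open>F\<close> is the identity; this accounts for the eigenvalue 1.\<close>

lemma graded_annihilator:
  "\<exists>Q. Q \<noteq> 0 \<and> (\<forall>\<mu>. poly Q \<mu> = 0 \<longrightarrow> \<mu> \<in> E) \<and> (\<forall>f\<in>mpow k. pact F Q f \<in> mpow (Suc k))"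
proof (cases k)
  case 0
  have "pact F [:- 1, 1:] f \<in> mpow (Suc 0)" for f
  proof -
    define c where "c = f (\<lambda>_. 0)"
    define f' where "f' = f - scale c fps_n_one"
    have f': "f' \<in> mpow (Suc 0)"
      by (auto simp: f'_def mpow_def mdeg_eq_0_iff c_def scale_def fps_n_one_def pointwise)
    have "F f' = F f - scale c fps_n_one"
      using F by (simp add: f'_def lin_diff lin_scale formal_diff_iff)
    then have "pact F [:- 1, 1:] f = F f' - f'"
      by (simp only: pact_linear_factor[OF lin] f'_def) simp
    also have "\<dots> \<in> mpow (Suc 0)" using f' filtered_mpow[OF filt f'] by (simp add: mpow_diff)
    finally show ?thesis .
  qed
  then show ?thesis using 0 E_one by (intro exI[of _ "[:- 1, 1:]"]) auto
next
  case (Suc j)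
  have "\<exists>Q. Q \<noteq> 0 \<and> (\<forall>\<mu>. poly Q \<mu> = 0 \<longrightarrow> \<mu> \<in> E) \<and>
      (\<forall>f\<in>mpow (Suc j). pact F Q f \<in> mpow (Suc (Suc j)))"
  proof (induction j)
    case 0
    then show ?case using q_nonzero q_roots q_pact by blast
  next
    case (Suc j)
    then obtain Q where Q: "Q \<noteq> 0" "\<And>\<mu>. poly Q \<mu> = 0 \<Longrightarrow> \<mu> \<in> E"
      "\<And>f. f \<in> mpow (Suc j) \<Longrightarrow> pact F Q f \<in> mpow (Suc (Suc j))" by blast
    obtain R e r where R: "finite R" "R \<subseteq> E" "\<And>f. f = (\<Sum>\<mu>\<in>R. pact F (e \<mu>) f)"
      "\<And>\<mu> f k. \<mu> \<in> R \<Longrightarrow> pact F q f \<in> mpow k \<Longrightarrow> pact F ([:- \<mu>, 1:] ^ r) (pact F (e \<mu>) f) \<in> mpow k"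
      using E_partial_fractions[OF q_nonzero q_roots] by metis
    obtain R' e' r' where R': "finite R'" "R' \<subseteq> E" "\<And>f. f = (\<Sum>\<mu>\<in>R'. pact F (e' \<mu>) f)"
      "\<And>\<mu> f k. \<mu> \<in> R' \<Longrightarrow> pact F Q f \<in> mpow k \<Longrightarrow> pact F ([:- \<mu>, 1:] ^ r') (pact F (e' \<mu>) f) \<in> mpow k"
      using E_partial_fractions[OF Q(1,2)] by metis
    define P where "P = (\<Prod>(\<mu>, \<nu>)\<in>R \<times> R'. [:- (\<mu> * \<nu>), 1:] ^ (r + r'))"
    have fin: "finite (R \<times> R')" using R(1) R'(1) by simp
    have "P \<noteq> 0" using fin by (auto simp: P_def)
    moreover have "\<mu> \<in> E" if "poly P \<mu> = 0" for \<mu>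
    proof -
      have "\<exists>x\<in>R \<times> R'. poly ([:- (fst x * snd x), 1:] ^ (r + r')) \<mu> = 0"
        using that fin by (auto simp: P_def poly_prod case_prod_beta)
      then obtain a b where "a \<in> R" "b \<in> R'" "\<mu> = a * b" by auto
      then show ?thesis using R(2) R'(2) E_mult by blast
    qed
    moreover have "pact F P f \<in> mpow (Suc (Suc (Suc j)))" if f: "f \<in> mpow (Suc (Suc j))" for f
    proof -
      have prod: "pact F P (fps_n_mult g h) \<in> mpow (Suc (Suc (Suc j)))"
        if g: "g \<in> mpow (Suc 0)" and h: "h \<in> mpow (Suc j)" for g h
      proof -
        have "fps_n_mult g h = (\<Sum>\<mu>\<in>R. \<Sum>\<nu>\<in>R'. fps_n_mult (pact F (e \<mu>) g) (pact F (e' \<nu>) h))"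
          by (subst R(3)[of g], subst R'(3)[of h])
            (simp only: fps_n_mult_sum_left fps_n_mult_sum_right, rule sum.swap)
        then have "pact F P (fps_n_mult g h) =
            (\<Sum>\<mu>\<in>R. \<Sum>\<nu>\<in>R'. pact F P (fps_n_mult (pact F (e \<mu>) g) (pact F (e' \<nu>) h)))"
          by (simp only: lin_sum[OF filtered_lin[OF filtered_pact[OF filt]]])
        also have "\<dots> \<in> mpow (Suc (Suc (Suc j)))"
        proof (intro mpow_sum)
          fix \<mu> \<nu> assume \<mu>\<nu>: "\<mu> \<in> R" "\<nu> \<in> R'"
          \<comment> \<open>Offsets 1 and j + 1 with gain 1: each factor is annihilated in its own
            graded piece, so the product moves one order beyond m^(j+2).\<close>
          have "pact F ([:- (\<mu> * \<nu>), 1:] ^ (r + r')) (fps_n_mult (pact F (e \<mu>) g) (pact F (e' \<nu>) h))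
              \<in> mpow (Suc 0 + Suc j + Suc 0)"
          proof (rule pact_power_mult_mpow[OF F])
            show "pact F (e \<mu>) g \<in> mpow (Suc 0)" "pact F (e' \<nu>) h \<in> mpow (Suc j)"
              using g h pact_mpow[OF filt] by auto
            show "pact F ([:- \<mu>, 1:] ^ r) (pact F (e \<mu>) g) \<in> mpow (Suc 0 + Suc 0)"
              using R(4)[OF \<mu>\<nu>(1) q_pact[OF g]] by simp
            show "pact F ([:- \<nu>, 1:] ^ r') (pact F (e' \<nu>) h) \<in> mpow (Suc j + Suc 0)"
              using R'(4)[OF \<mu>\<nu>(2) Q(3)[OF h]] by simp
          qed
          moreover have "[:- (\<mu> * \<nu>), 1:] ^ (r + r') dvd P"
            using \<mu>\<nu> dvd_prodI[OF fin, of "(\<mu>, \<nu>)" "\<lambda>(\<mu>, \<nu>). [:- (\<mu> * \<nu>), 1:] ^ (r + r')"]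
            unfolding P_def by (simp only: prod.case mem_Times_iff fst_conv snd_conv simp_thms)
          ultimately show "pact F P (fps_n_mult (pact F (e \<mu>) g) (pact F (e' \<nu>) h))
              \<in> mpow (Suc (Suc (Suc j)))"
            using pact_dvd_mpow[OF filt] by simp
        qed
        finally show ?thesis .
      qed
      obtain g where g: "\<And>i. g i \<in> mpow (Suc j)"
        "f = (\<Sum>i\<in>UNIV. fps_n_mult (fps_n_var i) (g i))"
        using mpow_Suc_decompose[OF f] by blast
      show ?thesis
        unfolding g(2) lin_sum[OF filtered_lin[OF filtered_pact[OF filt]]]
        by (intro mpow_sum prod fps_n_var_mpow g(1))
    qed
    ultimately show ?case by blast
  qed
  then show ?thesis using Suc by simp
qed

text \<open>Annihilators of successive graded pieces multiply to an annihilator of the jet space: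
  \<open>Q\<close> pushes everything into m^k and \<open>P\<close> pushes m^k one level
  further.\<close>

lemma jet_annihilator:
  "\<exists>Q. Q \<noteq> 0 \<and> (\<forall>\<mu>. poly Q \<mu> = 0 \<longrightarrow> \<mu> \<in> E) \<and> (\<forall>f. pact F Q f \<in> mpow k)"
proof (induction k)
  case 0
  then show ?case by (intro exI[of _ 1]) auto
next
  case (Suc k)
  then obtain Q where Q: "Q \<noteq> 0" "\<forall>\<mu>. poly Q \<mu> = 0 \<longrightarrow> \<mu> \<in> E" "\<forall>f. pact F Q f \<in> mpow k"
    by blast
  obtain P where P: "P \<noteq> 0" "\<forall>\<mu>. poly P \<mu> = 0 \<longrightarrow> \<mu> \<in> E" "\<forall>f\<in>mpow k. pact F P f \<in> mpow (Suc k)"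
    using graded_annihilator[of k] by blast
  have "pact F (P * Q) f \<in> mpow (Suc k)" for f
    using Q(3) P(3) by (simp add: pact_mult[OF lin])
  then show ?case using P Q by (intro exI[of _ "P * Q"]) auto
qed

section \<open>Generalised eigenspaces modulo m^(k+1)\<close>

definition geigen :: "complex \<Rightarrow> nat \<Rightarrow> 'n fps_n set" where
  "geigen \<mu> k = {f. \<exists>r. pact F ([:- \<mu>, 1:] ^ r) f \<in> mpow (Suc k)}"

lemma geigen_pact: "f \<in> geigen \<mu> k \<Longrightarrow> pact F p f \<in> geigen \<mu> k"
  unfolding geigen_def using pact_mpow[OF filt] pact_commute[OF lin] by fastforce

lemma geigen_F: "f \<in> geigen \<mu> k \<Longrightarrow> F f \<in> geigen \<mu> k"
  using geigen_pact[of f \<mu> k "[:0, 1:]"] by (simp add: pact_pCons[OF lin] lin_zero[OF lin])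

lemma geigen_anti: "f \<in> geigen \<mu> k \<Longrightarrow> j \<le> k \<Longrightarrow> f \<in> geigen \<mu> j"
  unfolding geigen_def using mpow_anti[of "Suc j" "Suc k"] by blast

lemma geigen_mult:
  assumes "g \<in> geigen \<mu> k" "h \<in> geigen \<nu> k"
  shows "fps_n_mult g h \<in> geigen (\<mu> * \<nu>) k"
proof -
  obtain r s where "pact F ([:- \<mu>, 1:] ^ r) g \<in> mpow (0 + Suc k)"
    "pact F ([:- \<nu>, 1:] ^ s) h \<in> mpow (0 + Suc k)"
    using assms by (auto simp: geigen_def)
  from pact_power_mult_mpow[OF F _ _ this] show ?thesis by (auto simp: geigen_def)
qed

lemma geigen_disjoint:
  assumes "f \<in> geigen \<mu> k" "f \<in> geigen \<nu> k" "\<mu> \<noteq> \<nu>"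
  shows "f \<in> mpow (Suc k)"
proof -
  obtain r s where rs: "pact F ([:- \<mu>, 1:] ^ r) f \<in> mpow (Suc k)"
    "pact F ([:- \<nu>, 1:] ^ s) f \<in> mpow (Suc k)"
    using assms by (auto simp: geigen_def)
  have "poly ([:- \<nu>, 1:] ^ s) \<mu> \<noteq> 0" using assms(3) by simp
  then obtain a b where ab: "a * [:- \<mu>, 1:] ^ r + b * [:- \<nu>, 1:] ^ s = 1"
    using bezout_linear_power by blast
  have "f = pact F (a * [:- \<mu>, 1:] ^ r + b * [:- \<nu>, 1:] ^ s) f" unfolding ab by simp
  also have "\<dots> = pact F a (pact F ([:- \<mu>, 1:] ^ r) f) + pact F b (pact F ([:- \<nu>, 1:] ^ s) f)"
    by (simp only: pact_add pact_mult[OF lin])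
  also have "\<dots> \<in> mpow (Suc k)" by (rule mpow_add; rule pact_mpow[OF filt]) (use rs in auto)
  finally show ?thesis .
qed

text \<open>The decomposition of \<open>f\<close> is an exact identity of power series; only the
  annihilation is modulo m^(k+1). The exponent common to all of \<open>R\<close> later bounds the
  nilpotency of the unipotent part.\<close>

definition decomposes :: "nat \<Rightarrow> complex set \<Rightarrow> (complex \<Rightarrow> complex poly) \<Rightarrow> bool" where
  "decomposes k R e \<longleftrightarrow> finite R \<and> R \<subseteq> E \<and> (\<forall>f. f = (\<Sum>\<mu>\<in>R. pact F (e \<mu>) f)) \<and>
     (\<exists>r. \<forall>\<mu>\<in>R. \<forall>f. pact F ([:- \<mu>, 1:] ^ r) (pact F (e \<mu>) f) \<in> mpow (Suc k))"

text \<open>Any admissible choice serves. An element of \<open>eigs k\<close> need not be an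
  eigenvalue on k-jets; its component then lies in m^(k+1).\<close>

definition eigs :: "nat \<Rightarrow> complex set" where
  "eigs k = (SOME R. \<exists>e. decomposes k R e)"

definition eproj :: "nat \<Rightarrow> complex \<Rightarrow> complex poly" where
  "eproj k = (SOME e. decomposes k (eigs k) e)"

lemma decomposes_eproj: "decomposes k (eigs k) (eproj k)"
proof -
  obtain Q where Q: "Q \<noteq> 0" "\<forall>\<mu>. poly Q \<mu> = 0 \<longrightarrow> \<mu> \<in> E" "\<forall>f. pact F Q f \<in> mpow (Suc k)"
    using jet_annihilator[of "Suc k"] by blast
  obtain R e r where R: "finite R" "R \<subseteq> E" "\<And>f. f = (\<Sum>\<mu>\<in>R. pact F (e \<mu>) f)"
    "\<And>\<mu> f k. \<mu> \<in> R \<Longrightarrow> pact F Q f \<in> mpow k \<Longrightarrow> pact F ([:- \<mu>, 1:] ^ r) (pact F (e \<mu>) f) \<in> mpow k"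
    using E_partial_fractions[OF Q(1)] Q(2) by metis
  have "decomposes k R e"
    unfolding decomposes_def
  proof (intro conjI allI)
    show "\<exists>r. \<forall>\<mu>\<in>R. \<forall>f. pact F ([:- \<mu>, 1:] ^ r) (pact F (e \<mu>) f) \<in> mpow (Suc k)"
      using R(4) Q(3) by blast
  qed (use R in auto)
  then have "\<exists>R. \<exists>e. decomposes k R e" by blast
  then have "\<exists>e. decomposes k (eigs k) e" unfolding eigs_def by (rule someI_ex)
  then show ?thesis unfolding eproj_def by (rule someI_ex)
qed

lemma eigs_E: "\<mu> \<in> eigs k \<Longrightarrow> \<mu> \<in> E"
  and eproj_sum: "(\<Sum>\<mu>\<in>eigs k. pact F (eproj k \<mu>) f) = f"
  using decomposes_eproj[of k] unfolding decomposes_def by auto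

lemma eproj_uniform:
  obtains r where "\<And>\<mu> f. \<mu> \<in> eigs k \<Longrightarrow> pact F ([:- \<mu>, 1:] ^ r) (pact F (eproj k \<mu>) f) \<in> mpow (Suc k)"
  using decomposes_eproj[of k] unfolding decomposes_def by blast

lemma eproj_geigen: "\<mu> \<in> eigs k \<Longrightarrow> pact F (eproj k \<mu>) f \<in> geigen \<mu> k"
  using eproj_uniform[of k] unfolding geigen_def by blast

lemma cong_on_geigen:
  assumes "lin \<phi>" "lin \<psi>"
    and "\<And>\<mu> g. \<mu> \<in> E \<Longrightarrow> g \<in> geigen \<mu> k \<Longrightarrow> \<phi> g - \<psi> g \<in> mpow (Suc k)"
  shows "\<phi> f - \<psi> f \<in> mpow (Suc k)"
proof -
  have "\<phi> f - \<psi> f = \<phi> (\<Sum>\<mu>\<in>eigs k. pact F (eproj k \<mu>) f) - \<psi> (\<Sum>\<mu>\<in>eigs k. pact F (eproj k \<mu>) f)"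
    by (simp only: eproj_sum)
  also have "\<dots> = (\<Sum>\<mu>\<in>eigs k. \<phi> (pact F (eproj k \<mu>) f) - \<psi> (pact F (eproj k \<mu>) f))"
    by (simp add: lin_sum assms(1,2) sum_subtractf)
  also have "\<dots> \<in> mpow (Suc k)"
    by (intro mpow_sum assms(3)[OF eigs_E eproj_geigen])
  finally show ?thesis .
qed

section \<open>Functions of the semisimple part\<close>

definition semi_jet :: "(complex \<Rightarrow> complex) \<Rightarrow> nat \<Rightarrow> 'n fps_n \<Rightarrow> 'n fps_n" where
  "semi_jet \<chi> k f = (\<Sum>\<mu>\<in>eigs k. scale (\<chi> \<mu>) (pact F (eproj k \<mu>) f))"

definition semi :: "(complex \<Rightarrow> complex) \<Rightarrow> 'n fps_n \<Rightarrow> 'n fps_n" where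
  "semi \<chi> f = (\<lambda>\<alpha>. semi_jet \<chi> (mdeg \<alpha>) f \<alpha>)"

lemma filtered_semi_jet: "filtered (semi_jet \<chi> k)"
  unfolding semi_jet_def by (intro filtered_sum filtered_scale filtered_pact filt)

text \<open>The \<nu>-component of \<open>f\<close> with \<nu> \<noteq> \<mu> lies in two
  generalised eigenspaces and so vanishes modulo m^(j+1). Allowing j < k compares the choices made
  at different jet orders.\<close>

lemma semi_jet_geigen:
  assumes "f \<in> geigen \<mu> j" "j \<le> k"
  shows "semi_jet \<chi> k f - scale (\<chi> \<mu>) f \<in> mpow (Suc j)"
proof -
  have "semi_jet \<chi> k f - scale (\<chi> \<mu>) f =
      (\<Sum>\<nu>\<in>eigs k. scale (\<chi> \<nu>) (pact F (eproj k \<nu>) f)) - scale (\<chi> \<mu>) (\<Sum>\<nu>\<in>eigs k. pact F (eproj k \<nu>) f)"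
    by (simp only: eproj_sum semi_jet_def)
  also have "\<dots> = (\<Sum>\<nu>\<in>eigs k. scale (\<chi> \<nu> - \<chi> \<mu>) (pact F (eproj k \<nu>) f))"
    by (simp add: scale_sum sum_subtractf scale_diff_left)
  also have "\<dots> \<in> mpow (Suc j)"
  proof (intro mpow_sum)
    fix \<nu> assume \<nu>: "\<nu> \<in> eigs k"
    show "scale (\<chi> \<nu> - \<chi> \<mu>) (pact F (eproj k \<nu>) f) \<in> mpow (Suc j)"
    proof (cases "\<nu> = \<mu>")
      case False
      have "pact F (eproj k \<nu>) f \<in> geigen \<nu> j"
        using eproj_geigen[OF \<nu>] geigen_anti assms(2) by blast
      then show ?thesis
        using geigen_disjoint[OF _ geigen_pact[OF assms(1)] False] by (intro mpow_scale)
    qed simp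
  qed
  finally show ?thesis .
qed

lemma semi_cong_jet: "semi \<chi> f - semi_jet \<chi> k f \<in> mpow (Suc k)"
proof -
  have "semi_jet \<chi> (mdeg \<alpha>) f \<alpha> = semi_jet \<chi> k f \<alpha>" if "mdeg \<alpha> \<le> k" for \<alpha>
  proof -
    have "semi_jet \<chi> (mdeg \<alpha>) f - semi_jet \<chi> k f \<in> mpow (Suc (mdeg \<alpha>))"
    proof (rule cong_on_geigen[OF filtered_lin filtered_lin, OF filtered_semi_jet filtered_semi_jet])
      fix \<mu> g assume g: "g \<in> geigen \<mu> (mdeg \<alpha>)"
      show "semi_jet \<chi> (mdeg \<alpha>) g - semi_jet \<chi> k g \<in> mpow (Suc (mdeg \<alpha>))"
        by (rule mpow_cong_common[OF semi_jet_geigen[OF g order_refl] semi_jet_geigen[OF g that]])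
    qed
    then show ?thesis by (auto simp: mpow_def pointwise)
  qed
  then show ?thesis by (auto simp: mpow_def semi_def pointwise)
qed

lemma filtered_semi: "filtered (semi \<chi>)"
  unfolding filtered_def lin_def
proof (intro conjI allI ballI)
  fix f g :: "'n fps_n" and c
  note l = filtered_lin[OF filtered_semi_jet]
  show "semi \<chi> (f + g) = semi \<chi> f + semi \<chi> g"
    by (simp add: semi_def lin_add[OF l] fun_eq_iff pointwise)
  show "semi \<chi> (scale c f) = scale c (semi \<chi> f)"
    by (simp add: semi_def lin_scale[OF l] fun_eq_iff scale_apply)
next
  fix k and f :: "'n fps_n" assume "f \<in> mpow k"
  then show "semi \<chi> f \<in> mpow k"
    using filtered_mpow[OF filtered_semi_jet] by (auto simp: mpow_def semi_def)
qed

lemma semi_geigen: "f \<in> geigen \<mu> k \<Longrightarrow> semi \<chi> f - scale (\<chi> \<mu>) f \<in> mpow (Suc k)"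
  by (rule mpow_cong_trans[OF semi_cong_jet semi_jet_geigen[OF _ order_refl]])

text \<open>Being scalar on each generalised eigenspace, modulo every m^(k+1), determines the
  operator. The algebra of the \<open>semi \<chi>\<close> is thus reduced to the algebra of the
  values of \<chi>.\<close>

lemma semi_eqI:
  assumes "filtered \<phi>"
    and "\<And>\<mu> f k. \<mu> \<in> E \<Longrightarrow> f \<in> geigen \<mu> k \<Longrightarrow> \<phi> f - scale (\<chi> \<mu>) f \<in> mpow (Suc k)"
  shows "\<phi> = semi \<chi>"
proof
  fix f
  show "\<phi> f = semi \<chi> f"
  proof (rule fps_n_eqI_mpow, rule cong_on_geigen[of \<phi> "semi \<chi>"])
    fix \<mu> f k assume "\<mu> \<in> E" and f: "f \<in> geigen \<mu> k"
    from mpow_cong_common[OF assms(2)[OF this] semi_geigen[OF f, of \<chi>]]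
    show "\<phi> f - semi \<chi> f \<in> mpow (Suc k)" .
  qed (use assms filtered_semi in \<open>auto intro: filtered_lin\<close>)
qed

lemma semi_cong: "(\<And>\<mu>. \<mu> \<in> E \<Longrightarrow> \<chi> \<mu> = \<chi>' \<mu>) \<Longrightarrow> semi \<chi> = semi \<chi>'"
  by (rule semi_eqI[OF filtered_semi]) (metis semi_geigen)

lemma semi_one: "semi (\<lambda>_. 1) = id"
  by (rule semi_eqI[symmetric, OF filtered_id(1)]) simp

lemma semi_comp: "semi \<chi> \<circ> semi \<chi>' = semi (\<lambda>\<mu>. \<chi> \<mu> * \<chi>' \<mu>)"
proof (rule semi_eqI)
  show "filtered (semi \<chi> \<circ> semi \<chi>')" by (intro filtered_comp filtered_semi)
  fix \<mu> f k assume f: "f \<in> geigen \<mu> k"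
  have "semi \<chi> (semi \<chi>' f) - semi \<chi> (scale (\<chi>' \<mu>) f) \<in> mpow (Suc k)"
    by (rule filtered_cong[OF filtered_semi semi_geigen[OF f]])
  moreover have "semi \<chi> (scale (\<chi>' \<mu>) f) - scale (\<chi> \<mu> * \<chi>' \<mu>) f \<in> mpow (Suc k)"
    using mpow_scale[OF semi_geigen[OF f], of "\<chi>' \<mu>" \<chi>]
    by (simp add: scale_diff lin_scale[OF filtered_lin[OF filtered_semi]] mult.commute)
  ultimately show "(semi \<chi> \<circ> semi \<chi>') f - scale (\<chi> \<mu> * \<chi>' \<mu>) f \<in> mpow (Suc k)"
    unfolding comp_apply by (rule mpow_cong_trans)
qed

text \<open>On k-jets \<open>semi \<chi>\<close> is a polynomial in \<open>F\<close>, hence commutes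
  with everything that commutes with \<open>F\<close>.\<close>

lemma semi_commute:
  assumes "filtered \<psi>" "\<psi> \<circ> F = F \<circ> \<psi>"
  shows "\<psi> \<circ> semi \<chi> = semi \<chi> \<circ> \<psi>"
proof
  fix f
  show "(\<psi> \<circ> semi \<chi>) f = (semi \<chi> \<circ> \<psi>) f"
  proof (rule fps_n_eqI_mpow)
    fix k
    have "\<psi> (semi \<chi> f) - \<psi> (semi_jet \<chi> k f) \<in> mpow (Suc k)"
      by (rule filtered_cong[OF assms(1) semi_cong_jet])
    moreover have "\<psi> (semi_jet \<chi> k f) = semi_jet \<chi> k (\<psi> f)"
      using filtered_lin[OF assms(1)]
      by (simp add: semi_jet_def lin_sum lin_scale pact_intertwine[OF _ assms(2)])
    ultimately show "(\<psi> \<circ> semi \<chi>) f - (semi \<chi> \<circ> \<psi>) f \<in> mpow (Suc k)"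
      using mpow_cong_common[OF _ semi_cong_jet[of \<chi> "\<psi> f" k]] by simp
  qed
qed

definition character :: "(complex \<Rightarrow> complex) \<Rightarrow> bool" where
  "character \<chi> \<longleftrightarrow> \<chi> 1 = 1 \<and> (\<forall>\<mu>\<in>E. \<forall>\<nu>\<in>E. \<chi> (\<mu> * \<nu>) = \<chi> \<mu> * \<chi> \<nu>) \<and> (\<forall>\<mu>\<in>E. \<chi> \<mu> \<noteq> 0)"

text \<open>Both sides are expanded over pairs of components. The product of a \<mu>-component and a
  \<nu>-component belongs to \<mu>\<nu>, so the claim becomes \<chi>(\<mu>\<nu>) = \<chi>(\<mu>)
  \<chi>(\<nu>).\<close>

lemma semi_mult:
  assumes "character \<chi>"
  shows "semi \<chi> (fps_n_mult f g) = fps_n_mult (semi \<chi> f) (semi \<chi> g)"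
proof (rule fps_n_eqI_mpow)
  fix k
  let ?P = "\<lambda>\<mu>. pact F (eproj k \<mu>)"
  note l = filtered_lin[OF filtered_semi]
  have "semi \<chi> (fps_n_mult f g) = semi \<chi> (fps_n_mult (\<Sum>\<mu>\<in>eigs k. ?P \<mu> f) (\<Sum>\<nu>\<in>eigs k. ?P \<nu> g))"
    by (simp only: eproj_sum)
  also have "\<dots> = (\<Sum>\<mu>\<in>eigs k. \<Sum>\<nu>\<in>eigs k. semi \<chi> (fps_n_mult (?P \<mu> f) (?P \<nu> g)))"
    by (simp only: fps_n_mult_sum_left fps_n_mult_sum_right lin_sum[OF l]) (rule sum.swap)
  finally have 1: "semi \<chi> (fps_n_mult f g) = \<dots>" .
  have "fps_n_mult (semi \<chi> f) (semi \<chi> g) =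
      fps_n_mult (semi \<chi> (\<Sum>\<mu>\<in>eigs k. ?P \<mu> f)) (semi \<chi> (\<Sum>\<nu>\<in>eigs k. ?P \<nu> g))"
    by (simp only: eproj_sum)
  also have "\<dots> = (\<Sum>\<mu>\<in>eigs k. \<Sum>\<nu>\<in>eigs k. fps_n_mult (semi \<chi> (?P \<mu> f)) (semi \<chi> (?P \<nu> g)))"
    by (simp only: fps_n_mult_sum_left fps_n_mult_sum_right lin_sum[OF l]) (rule sum.swap)
  finally have 2: "fps_n_mult (semi \<chi> f) (semi \<chi> g) = \<dots>" .
  show "semi \<chi> (fps_n_mult f g) - fps_n_mult (semi \<chi> f) (semi \<chi> g) \<in> mpow (Suc k)"
    unfolding 1 2 sum_subtractf[symmetric]
  proof (intro mpow_sum)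
    fix \<mu> \<nu> assume \<mu>\<nu>: "\<mu> \<in> eigs k" "\<nu> \<in> eigs k"
    let ?f = "?P \<mu> f" and ?g = "?P \<nu> g"
    note f = eproj_geigen[OF \<mu>\<nu>(1), of f] and g = eproj_geigen[OF \<mu>\<nu>(2), of g]
    have "semi \<chi> (fps_n_mult ?f ?g) - scale (\<chi> (\<mu> * \<nu>)) (fps_n_mult ?f ?g) \<in> mpow (Suc k)"
      by (rule semi_geigen[OF geigen_mult[OF f g]])
    moreover have "scale (\<chi> (\<mu> * \<nu>)) (fps_n_mult ?f ?g) =
        fps_n_mult (scale (\<chi> \<mu>) ?f) (scale (\<chi> \<nu>) ?g)"
      using assms \<mu>\<nu> eigs_E
      by (simp add: character_def fps_n_mult_scale_left fps_n_mult_scale_right mult.commute)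
    moreover have "fps_n_mult (semi \<chi> ?f) (semi \<chi> ?g) - fps_n_mult (scale (\<chi> \<mu>) ?f) (scale (\<chi> \<nu>) ?g)
        \<in> mpow (Suc k)"
      by (intro mpow_mult_cong semi_geigen f g)
    ultimately show "semi \<chi> (fps_n_mult ?f ?g) - fps_n_mult (semi \<chi> ?f) (semi \<chi> ?g) \<in> mpow (Suc k)"
      using mpow_cong_common by metis
  qed
qed

lemma semi_formal_diff:
  assumes "character \<chi>" shows "semi \<chi> \<in> formal_diff"
  unfolding formal_diff_iff
proof (intro conjI allI ballI)
  have "semi \<chi> \<circ> semi (\<lambda>\<mu>. inverse (\<chi> \<mu>)) = id" "semi (\<lambda>\<mu>. inverse (\<chi> \<mu>)) \<circ> semi \<chi> = id"
    using assms unfolding semi_comp semi_one[symmetric]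
    by (auto intro!: semi_cong simp: character_def)
  then show "bij (semi \<chi>)" by (intro o_bij)
  show "semi \<chi> (fps_n_mult f g) = fps_n_mult (semi \<chi> f) (semi \<chi> g)" for f g
    by (rule semi_mult[OF assms])
  show "semi \<chi> fps_n_one = fps_n_one"
  proof (rule fps_n_eqI_mpow)
    fix k
    have "pact F ([:- 1, 1:] ^ 1) fps_n_one = F fps_n_one - scale 1 fps_n_one"
      by (simp only: power_one_right pact_linear_factor[OF lin])
    also have "\<dots> = 0" using F by (simp add: formal_diff_iff)
    finally have "fps_n_one \<in> geigen 1 k" unfolding geigen_def by (metis (mono_tags) mem_Collect_eq mpow_zero)
    from semi_geigen[OF this, of \<chi>] show "semi \<chi> fps_n_one - fps_n_one \<in> mpow (Suc k)"
      using assms by (simp add: character_def)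
  qed
qed (use filtered_semi filtered_lin filtered_mpow in blast)+

lemma jet_entry_semi:
  "jet_entry (semi \<chi>) \<alpha> \<beta> =
    (\<Sum>\<mu>\<in>eigs (mdeg \<alpha>). \<chi> \<mu> * pact F (eproj (mdeg \<alpha>) \<mu>) (fps_n_monom \<beta>) \<alpha>)"
  by (simp add: jet_entry_def semi_def semi_jet_def sum_fps_n_apply scale_apply)

section \<open>The multiplicative Jordan decomposition\<close>

lemma character_inverse: "character inverse"
  using E_nonzero by (auto simp: character_def)

definition unip :: "'n fps_n \<Rightarrow> 'n fps_n" where
  "unip = semi inverse \<circ> F"

lemma unip_formal_diff: "unip \<in> formal_diff"
  unfolding unip_def by (intro formal_diff_comp semi_formal_diff character_inverse F)

lemma semi_unip: "semi (\<lambda>\<mu>. \<mu>) \<circ> unip = F"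
proof -
  have "semi (\<lambda>\<mu>. \<mu>) \<circ> semi inverse = id"
    unfolding semi_comp semi_one[symmetric] using E_nonzero
    by (intro semi_cong) (metis right_inverse)
  then show ?thesis unfolding unip_def by (metis comp_assoc id_comp)
qed

lemma unip_commute:
  assumes "filtered \<psi>" "\<psi> \<circ> F = F \<circ> \<psi>"
  shows "\<psi> \<circ> unip = unip \<circ> \<psi>"
  unfolding unip_def using semi_commute[OF assms] assms(2) by (metis comp_assoc)

text \<open>On the \<mu>-part, \<open>unip\<close> minus the identity agrees with (F - \<mu>)/\<mu>
  modulo m^(k+1), and the common exponent for \<open>eigs k\<close> annihilates all parts
  simultaneously.\<close>

lemma unip_nilpotent: "\<exists>r. \<forall>f. ((\<lambda>f. unip f - f) ^^ r) f \<in> mpow (Suc k)"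
proof -
  define N where "N = (\<lambda>f. unip f - f)"
  have N: "filtered N"
    unfolding N_def by (intro filtered_diff filtered_id formal_diff_filtered unip_formal_diff)
  let ?L = "\<lambda>\<mu>. [:- \<mu>, 1:] :: complex poly"
  have step: "N f - scale (inverse \<mu>) (pact F (?L \<mu>) f) \<in> mpow (Suc k)"
    if "\<mu> \<in> E" "f \<in> geigen \<mu> k" for \<mu> f
  proof -
    have "semi inverse (F f) - scale (inverse \<mu>) (F f) \<in> mpow (Suc k)"
      by (rule semi_geigen[OF geigen_F[OF that(2)]])
    moreover have "scale (inverse \<mu>) (pact F (?L \<mu>) f) = scale (inverse \<mu>) (F f) - f"
    proof -
      have "inverse \<mu> * \<mu> = 1" using that(1) E_nonzero by (metis left_inverse)
      then show ?thesis by (simp only: pact_linear_factor[OF lin] scale_diff scale_scale scale_one)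
    qed
    ultimately show ?thesis by (simp add: N_def unip_def)
  qed
  have pow: "(N ^^ j) f - scale (inverse \<mu> ^ j) (pact F (?L \<mu> ^ j) f) \<in> mpow (Suc k)"
    if "\<mu> \<in> E" "f \<in> geigen \<mu> k" for \<mu> f j
  proof (induction j)
    case (Suc j)
    let ?g = "pact F (?L \<mu> ^ j) f"
    have "(N ^^ Suc j) f - scale (inverse \<mu> ^ j) (N ?g) \<in> mpow (Suc k)"
      using filtered_cong[OF N Suc.IH] by (simp add: lin_scale filtered_lin[OF N])
    moreover have "scale (inverse \<mu> ^ j) (N ?g) - scale (inverse \<mu> ^ Suc j) (pact F (?L \<mu> ^ Suc j) f)
        \<in> mpow (Suc k)"
      using mpow_scale[OF step[OF that(1) geigen_pact[OF that(2)]], of "inverse \<mu> ^ j" "?L \<mu> ^ j"]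
      by (simp only: scale_diff scale_scale power_Suc pact_mult[OF lin] mult.commute)
    ultimately show ?case by (rule mpow_cong_trans)
  qed simp
  obtain r where r: "\<And>\<mu> f. \<mu> \<in> eigs k \<Longrightarrow> pact F (?L \<mu> ^ r) (pact F (eproj k \<mu>) f) \<in> mpow (Suc k)"
    using eproj_uniform[of k] by blast
  have "(N ^^ r) f \<in> mpow (Suc k)" for f
  proof -
    have "(N ^^ r) f = (\<Sum>\<mu>\<in>eigs k. (N ^^ r) (pact F (eproj k \<mu>) f))"
      by (simp only: lin_sum[OF filtered_lin[OF filtered_funpow[OF N]], symmetric] eproj_sum)
    also have "\<dots> \<in> mpow (Suc k)"
    proof (intro mpow_sum)
      fix \<mu> assume \<mu>: "\<mu> \<in> eigs k"
      show "(N ^^ r) (pact F (eproj k \<mu>) f) \<in> mpow (Suc k)"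
        using pow[OF eigs_E[OF \<mu>] eproj_geigen[OF \<mu>]] mpow_scale[OF r[OF \<mu>]] by (rule mpow_cong_mem)
    qed
    finally show ?thesis .
  qed
  then show ?thesis unfolding N_def by blast
qed

end

section \<open>Complex powers of a unipotent automorphism\<close>

definition is_poly :: "(complex \<Rightarrow> complex) \<Rightarrow> bool" where
  "is_poly h \<longleftrightarrow> (\<exists>p. \<forall>z. h z = poly p z)"

lemma is_poly_const: "is_poly (\<lambda>z. c)"
  unfolding is_poly_def by (rule exI[of _ "[:c:]"]) simp

lemma is_poly_ident: "is_poly (\<lambda>z. z)"
  unfolding is_poly_def by (rule exI[of _ "[:0, 1:]"]) simp

lemma is_poly_add: "is_poly g \<Longrightarrow> is_poly h \<Longrightarrow> is_poly (\<lambda>z. g z + h z)"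
  unfolding is_poly_def by (metis poly_add)

lemma is_poly_mult: "is_poly g \<Longrightarrow> is_poly h \<Longrightarrow> is_poly (\<lambda>z. g z * h z)"
  unfolding is_poly_def by (metis poly_mult)

lemma is_poly_compose: "is_poly g \<Longrightarrow> is_poly h \<Longrightarrow> is_poly (\<lambda>z. g (h z))"
  unfolding is_poly_def by (metis poly_pcompose)

lemma is_poly_sum: "(\<And>i. i \<in> I \<Longrightarrow> is_poly (h i)) \<Longrightarrow> is_poly (\<lambda>z. \<Sum>i\<in>I. h i z)"
  by (induction I rule: infinite_finite_induct) (auto intro: is_poly_const is_poly_add)

lemma is_poly_prod: "(\<And>i. i \<in> I \<Longrightarrow> is_poly (h i)) \<Longrightarrow> is_poly (\<lambda>z. \<Prod>i\<in>I. h i z)"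
  by (induction I rule: infinite_finite_induct) (auto intro: is_poly_const is_poly_mult)

lemma is_poly_gbinomial: "is_poly (\<lambda>z. z gchoose j)"
proof -
  have "is_poly (\<lambda>z. z + - of_nat i)" for i
    by (intro is_poly_add is_poly_ident is_poly_const)
  then have "is_poly (\<lambda>z. (\<Prod>i = 0..<j. z + - of_nat i) * inverse (fact j))"
    by (intro is_poly_mult is_poly_prod is_poly_const)
  then show ?thesis by (simp add: gbinomial_prod_rev field_simps)
qed

lemma is_poly_eqI:
  assumes "is_poly g" "is_poly h" "\<And>m::nat. g (of_nat m) = h (of_nat m)"
  shows "g z = h z"
proof -
  obtain p r where p: "\<And>z. g z = poly p z" and r: "\<And>z. h z = poly r z"
    using assms(1,2) unfolding is_poly_def by blast
  have "range (of_nat :: nat \<Rightarrow> complex) \<subseteq> {z. poly (p - r) z = 0}"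
    using assms(3) p r by auto
  moreover have "infinite (range (of_nat :: nat \<Rightarrow> complex))"
    by (simp add: finite_image_iff inj_of_nat)
  ultimately have "infinite {z. poly (p - r) z = 0}" using finite_subset by blast
  then have "p - r = 0" using poly_roots_finite by blast
  then show ?thesis by (simp add: p r)
qed

text \<open>Complex powers of a unipotent automorphism \<open>U\<close> are given by the binomial series
  \<open>(1 + N)\<^sup>z\<close> with \<open>N = U - 1\<close>.  Every coefficient of the result is a polynomial in \<open>z\<close>, hence
  all algebraic identities follow from the case where \<open>z\<close> is a natural number.\<close>

locale unipotent =
  fixes U :: "'n::finite fps_n \<Rightarrow> 'n fps_n"
  assumes U: "U \<in> formal_diff"
    and nilpotent: "\<And>k. \<exists>r. \<forall>f. ((\<lambda>f. U f - f) ^^ r) f \<in> mpow (Suc k)"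
begin

definition N :: "'n fps_n \<Rightarrow> 'n fps_n" where
  "N f = U f - f"

definition nilidx :: "nat \<Rightarrow> nat" where
  "nilidx k = (SOME r. \<forall>f. (N ^^ r) f \<in> mpow (Suc k))"

definition upow :: "complex \<Rightarrow> 'n fps_n \<Rightarrow> 'n fps_n" where
  "upow z f = (\<lambda>\<alpha>. \<Sum>j<nilidx (mdeg \<alpha>). (z gchoose j) * (N ^^ j) f \<alpha>)"

lemma filtered_N_pow: "filtered (N ^^ j)"
  using filtered_diff[OF formal_diff_filtered[OF U] filtered_id(2)]
  by (intro filtered_funpow) (simp add: N_def[abs_def])

lemma N_pow_mpow:
  assumes "nilidx k \<le> j" shows "(N ^^ j) f \<in> mpow (Suc k)"
proof -
  have "\<exists>r. \<forall>f. (N ^^ r) f \<in> mpow (Suc k)" using nilpotent[of k] by (simp add: N_def[abs_def])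
  then have "\<forall>f. (N ^^ nilidx k) f \<in> mpow (Suc k)" unfolding nilidx_def by (rule someI_ex)
  moreover have "(N ^^ j) f = (N ^^ nilidx k) ((N ^^ (j - nilidx k)) f)"
    using assms by (metis comp_apply funpow_add le_add_diff_inverse)
  ultimately show ?thesis by simp
qed

lemma upow_eq:
  assumes "nilidx (mdeg \<alpha>) \<le> M"
  shows "upow z f \<alpha> = (\<Sum>j<M. (z gchoose j) * (N ^^ j) f \<alpha>)"
  unfolding upow_def
proof (rule sum.mono_neutral_left)
  show "\<forall>j\<in>{..<M} - {..<nilidx (mdeg \<alpha>)}. (z gchoose j) * (N ^^ j) f \<alpha> = 0"
    using N_pow_mpow[of "mdeg \<alpha>" _ f] by (auto simp: mpow_def)
qed (use assms in auto)

text \<open>Pascal's rule drives the induction. Any bound \<open>M\<close> beyond \<open>m\<close>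
  is allowed, as further binomial coefficients vanish; it can then be matched with the truncation in
  \<open>upow\<close>.\<close>

lemma U_pow_binomial:
  assumes "m < M"
  shows "(U ^^ m) f = (\<Sum>j<M. scale (of_nat m gchoose j) ((N ^^ j) f))"
  using assms
proof (induction m arbitrary: M)
  case 0
  then obtain K where "M = Suc K" using gr0_implies_Suc by blast
  then show ?case by (simp add: sum.lessThan_Suc_shift gbinomial_0_left del: sum.lessThan_Suc)
next
  case (Suc m)
  then obtain K where K: "M = Suc K" "m < K" by (cases M) auto
  have U': "U g = g + N g" for g by (simp add: N_def)
  have pascal: "(of_nat m gchoose Suc j) + (of_nat m gchoose j) = (of_nat (Suc m) gchoose Suc j :: complex)"
    for j using gbinomial_Suc_Suc[of "of_nat m :: complex" j] by (simp add: add.commute)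
  have "(U ^^ Suc m) f = (U ^^ m) f + N ((U ^^ m) f)" by (simp add: U')
  also have "N ((U ^^ m) f) = (\<Sum>j<K. scale (of_nat m gchoose j) ((N ^^ Suc j) f))"
    using filtered_lin[OF filtered_N_pow[of 1]] by (simp add: Suc.IH[OF K(2)] lin_sum lin_scale)
  also have "(U ^^ m) f = f + (\<Sum>j<K. scale (of_nat m gchoose Suc j) ((N ^^ Suc j) f))"
    using Suc.IH[of "Suc K"] K by (simp add: sum.lessThan_Suc_shift del: sum.lessThan_Suc funpow.simps)
  finally have "(U ^^ Suc m) f = f + (\<Sum>j<K. scale (of_nat (Suc m) gchoose Suc j) ((N ^^ Suc j) f))"
    by (simp only: add.assoc sum.distrib[symmetric] scale_add_left[symmetric] pascal)
  then show ?case
    by (simp add: K(1) sum.lessThan_Suc_shift del: sum.lessThan_Suc funpow.simps)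
qed

lemma upow_nat: "upow (of_nat m) f = (U ^^ m) f"
proof
  fix \<alpha> :: "'n \<Rightarrow> nat"
  define M where "M = max (Suc m) (nilidx (mdeg \<alpha>))"
  have "m < M" "nilidx (mdeg \<alpha>) \<le> M" by (auto simp: M_def)
  then show "upow (of_nat m) f \<alpha> = (U ^^ m) f \<alpha>"
    by (simp add: upow_eq U_pow_binomial[of m M] sum_fps_n_apply scale_apply)
qed

lemma upow_0: "upow 0 = id"
  using upow_nat[of 0] by auto

lemma upow_1: "upow 1 = U"
  using upow_nat[of 1] by auto

lemma is_poly_upow: "is_poly (\<lambda>z. upow z f \<alpha>)"
  unfolding upow_def by (intro is_poly_sum is_poly_mult is_poly_gbinomial is_poly_const)

lemma filtered_upow: "filtered (upow z)"
  unfolding filtered_def lin_def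
proof (intro conjI allI ballI)
  fix f g :: "'n fps_n" and c
  note l = filtered_lin[OF filtered_N_pow]
  show "upow z (f + g) = upow z f + upow z g"
    by (simp add: upow_def lin_add[OF l] fun_eq_iff pointwise algebra_simps sum.distrib)
  show "upow z (scale c f) = scale c (upow z f)"
    by (simp add: upow_def lin_scale[OF l] fun_eq_iff scale_apply sum_distrib_left algebra_simps)
next
  fix k and f :: "'n fps_n" assume f: "f \<in> mpow k"
  show "upow z f \<in> mpow k"
    using filtered_mpow[OF filtered_N_pow f] by (auto simp: mpow_def upow_def)
qed

text \<open>A filtered map uses finitely many input coefficients for each output coefficient, so
  polynomial dependence on \<open>z\<close> survives.\<close>

lemma is_poly_filtered_upow: "filtered \<phi> \<Longrightarrow> is_poly (\<lambda>z. \<phi> (upow z f) \<alpha>)"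
  by (simp only: filtered_apply_eq[of \<phi>])
    (intro is_poly_sum is_poly_mult is_poly_upow is_poly_const)

text \<open>The two exponents are freed in turn: for natural \<open>w\<close> both sides are
  polynomials in \<open>z\<close> that agree on the naturals; then, for arbitrary fixed
  \<open>z\<close>, they are polynomials in \<open>w\<close>.\<close>

lemma upow_add: "upow z \<circ> upow w = upow (z + w)"
proof (intro ext)
  fix f \<alpha>
  have nat: "upow z (upow (of_nat m) f) \<alpha> = upow (z + of_nat m) f \<alpha>" for m z
  proof (rule is_poly_eqI[of "\<lambda>z. upow z (upow (of_nat m) f) \<alpha>" "\<lambda>z. upow (z + of_nat m) f \<alpha>"])
    show "is_poly (\<lambda>z. upow z (upow (of_nat m) f) \<alpha>)" by (rule is_poly_upow)
    show "is_poly (\<lambda>z. upow (z + of_nat m) f \<alpha>)"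
      using is_poly_compose[OF is_poly_upow is_poly_add[OF is_poly_ident is_poly_const]] .
    show "upow (of_nat k) (upow (of_nat m) f) \<alpha> = upow (of_nat k + of_nat m) f \<alpha>" for k
      unfolding of_nat_add[symmetric] upow_nat by (simp add: funpow_add)
  qed
  have "upow z (upow w f) \<alpha> = upow (z + w) f \<alpha>"
  proof (rule is_poly_eqI[of "\<lambda>w. upow z (upow w f) \<alpha>" "\<lambda>w. upow (z + w) f \<alpha>"])
    show "is_poly (\<lambda>w. upow z (upow w f) \<alpha>)"
      by (rule is_poly_filtered_upow[OF filtered_upow])
    show "is_poly (\<lambda>w. upow (z + w) f \<alpha>)"
      using is_poly_compose[OF is_poly_upow is_poly_add[OF is_poly_const is_poly_ident]] .
  qed (rule nat)
  then show "(upow z \<circ> upow w) f \<alpha> = upow (z + w) f \<alpha>" by simp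
qed

lemma upow_formal_diff: "upow z \<in> formal_diff"
  unfolding formal_diff_iff
proof (intro conjI allI ballI)
  have "upow z \<circ> upow (- z) = id" "upow (- z) \<circ> upow z = id"
    unfolding upow_add by (simp_all add: upow_0)
  then show "bij (upow z)" by (intro o_bij)
  have Um: "(U ^^ m) (fps_n_mult f g) = fps_n_mult ((U ^^ m) f) ((U ^^ m) g)"
    "(U ^^ m) fps_n_one = fps_n_one" for m f g
    using U by (induction m) (auto simp: formal_diff_iff)
  show "upow z (fps_n_mult f g) = fps_n_mult (upow z f) (upow z g)" for f g
  proof
    fix \<alpha>
    show "upow z (fps_n_mult f g) \<alpha> = fps_n_mult (upow z f) (upow z g) \<alpha>"
    proof (rule is_poly_eqI[of "\<lambda>z. upow z (fps_n_mult f g) \<alpha>"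
          "\<lambda>z. fps_n_mult (upow z f) (upow z g) \<alpha>"])
      show "is_poly (\<lambda>z. fps_n_mult (upow z f) (upow z g) \<alpha>)"
        unfolding fps_n_mult_def by (intro is_poly_sum is_poly_mult is_poly_upow)
    qed (simp_all add: is_poly_upow upow_nat Um)
  qed
  show "upow z fps_n_one = fps_n_one"
  proof
    fix \<alpha>
    show "upow z fps_n_one \<alpha> = fps_n_one \<alpha>"
      by (rule is_poly_eqI[of "\<lambda>z. upow z fps_n_one \<alpha>" "\<lambda>z. fps_n_one \<alpha>"])
        (simp_all add: is_poly_upow is_poly_const upow_nat Um)
  qed
qed (use filtered_upow filtered_lin filtered_mpow in blast)+

lemma upow_commute:
  assumes "filtered \<psi>" "\<psi> \<circ> U = U \<circ> \<psi>"
  shows "\<psi> \<circ> upow z = upow z \<circ> \<psi>"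
proof (intro ext)
  fix f \<alpha>
  have "\<psi> (U g) = U (\<psi> g)" for g using assms(2) by (metis comp_apply)
  then have m: "\<psi> ((U ^^ m) f) = (U ^^ m) (\<psi> f)" for m by (induction m) auto
  have "\<psi> (upow z f) \<alpha> = upow z (\<psi> f) \<alpha>"
    by (rule is_poly_eqI[of "\<lambda>z. \<psi> (upow z f) \<alpha>" "\<lambda>z. upow z (\<psi> f) \<alpha>"])
      (simp_all add: is_poly_filtered_upow[OF assms(1)] is_poly_upow upow_nat m)
  then show "(\<psi> \<circ> upow z) f \<alpha> = (upow z \<circ> \<psi>) f \<alpha>" by simp
qed

end

section \<open>The algebraic group of a single formal diffeomorphism\<close>

interpretation fps_n: vector_space scale
  by standard (auto simp: scale_add scale_add_left)

text \<open>Linear dependence is a property of sets, whereas iterates of an operator form a family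
  that may repeat. A repetition is a relation by itself, with coefficients 1 and -1.\<close>

lemma span_linear_relation:
  fixes w :: "nat \<Rightarrow> 'n fps_n"
  assumes "finite T" "\<And>j. w j \<in> fps_n.span T"
  obtains c where "\<exists>j\<le>card T. c j \<noteq> 0" "(\<Sum>j\<le>card T. scale (c j) (w j)) = 0"
proof (cases "inj_on w {..card T}")
  case True
  have "fps_n.dependent (w ` {..card T})"
  proof (rule ccontr)
    assume "\<not> fps_n.dependent (w ` {..card T})"
    from fps_n.independent_span_bound[OF assms(1) this] have "card (w ` {..card T}) \<le> card T"
      using assms(2) by blast
    with True show False by (simp add: card_image)
  qed
  then obtain S u where S: "finite S" "S \<subseteq> w ` {..card T}" "\<exists>v\<in>S. u v \<noteq> 0"
    "(\<Sum>v\<in>S. scale (u v) v) = 0"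
    unfolding fps_n.dependent_explicit by blast
  define c where "c = (\<lambda>j. if w j \<in> S then u (w j) else 0)"
  have "\<exists>j\<le>card T. c j \<noteq> 0" using S(2,3) by (fastforce simp: c_def)
  moreover have "(\<Sum>j\<le>card T. scale (c j) (w j)) = (\<Sum>j | j \<le> card T \<and> w j \<in> S. scale (u (w j)) (w j))"
    by (intro sum.mono_neutral_cong_right) (auto simp: c_def)
  moreover have "\<dots> = (\<Sum>v\<in>S. scale (u v) v)"
  proof (rule sum.reindex_cong[symmetric, of w])
    show "inj_on w {j. j \<le> card T \<and> w j \<in> S}" using True by (rule inj_on_subset) auto
  qed (use S(2) in auto)
  ultimately show ?thesis using S(4) that by metis
next
  case False
  then obtain i j where ij: "i \<le> card T" "j \<le> card T" "i \<noteq> j" "w i = w j"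
    by (auto simp: inj_on_def)
  define c where "c = (\<lambda>k. if k = i then 1 else if k = j then - 1 else (0::complex))"
  have "(\<Sum>k\<le>card T. scale (c k) (w k)) = (\<Sum>k\<in>{i, j}. scale (c k) (w k))"
    using ij by (intro sum.mono_neutral_right) (auto simp: c_def)
  also have "\<dots> = 0" using ij by (simp add: c_def scale_minus_left)
  finally have "(\<Sum>k\<le>card T. scale (c k) (w k)) = 0" .
  moreover have "\<exists>k\<le>card T. c k \<noteq> 0" using ij(1) by (intro exI[of _ i]) (simp add: c_def)
  ultimately show ?thesis using that by blast
qed

text \<open>A representative of the class in m/m^2 inside the span of the variables; relations
  modulo m^2 become exact linear relations there.\<close>

definition linpart :: "'n::finite fps_n \<Rightarrow> 'n fps_n" where
  "linpart f = (\<Sum>i\<in>UNIV. scale (f (\<lambda>j. if j = i then 1 else 0)) (fps_n_var i))"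

lemma linpart_sum_scale: "linpart (\<Sum>j\<in>J. scale (c j) (g j)) = (\<Sum>j\<in>J. scale (c j) (linpart (g j)))"
proof -
  have "linpart (\<Sum>j\<in>J. scale (c j) (g j)) =
      (\<Sum>i\<in>UNIV. \<Sum>j\<in>J. scale (c j * g j (\<lambda>j. if j = i then 1 else 0)) (fps_n_var i))"
    unfolding linpart_def by (simp only: sum_fps_n_apply scale_sum_left scale_apply)
  also have "\<dots> = (\<Sum>j\<in>J. scale (c j) (linpart (g j)))"
    unfolding linpart_def by (subst sum.swap) (simp add: scale_sum)
  finally show ?thesis .
qed

lemma mdeg_eq_1E:
  assumes "mdeg \<alpha> = 1" obtains i where "\<alpha> = (\<lambda>j. if j = i then 1 else 0)"
proof -
  obtain i where i: "\<alpha> i \<noteq> 0" using assms by (fastforce simp: mdeg_def)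
  have "mdeg \<alpha> = \<alpha> i + sum \<alpha> (UNIV - {i})" unfolding mdeg_def by (rule sum.remove) auto
  with assms i have "\<alpha> i = 1" "sum \<alpha> (UNIV - {i}) = 0" by linarith+
  then have "\<alpha> = (\<lambda>j. if j = i then 1 else 0)" by auto
  then show ?thesis by (rule that)
qed

lemma linpart_cong:
  assumes "f \<in> mpow (Suc 0)" shows "f - linpart f \<in> mpow (Suc (Suc 0))"
proof -
  have ind: "(\<lambda>j. if j = i then 1 else (0::nat)) = (\<lambda>j. if j = k then 1 else 0) \<longleftrightarrow> i = k" for i k :: 'a
    by (metis zero_neq_one)
  have deg1: "linpart f (\<lambda>j. if j = k then 1 else 0) = f (\<lambda>j. if j = k then 1 else 0)" for k
  proof -
    have "linpart f (\<lambda>j. if j = k then 1 else 0) =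
        (\<Sum>i\<in>UNIV. if i = k then f (\<lambda>j. if j = i then 1 else 0) else 0)"
      unfolding linpart_def sum_fps_n_apply scale_apply fps_n_var_def fps_n_monom_def ind
      by (rule sum.cong) auto
    then show ?thesis by simp
  qed
  have deg0: "linpart f \<in> mpow (Suc 0)"
    unfolding linpart_def by (intro mpow_sum mpow_scale fps_n_var_mpow)
  have "(f - linpart f) \<alpha> = 0" if "mdeg \<alpha> < Suc (Suc 0)" for \<alpha>
  proof (cases "mdeg \<alpha> = 1")
    case True
    then obtain k where "\<alpha> = (\<lambda>j. if j = k then 1 else 0)" by (rule mdeg_eq_1E)
    with deg1 show ?thesis by (simp add: pointwise)
  next
    case False
    with that have "mdeg \<alpha> < Suc 0" by simp
    with assms deg0 show ?thesis by (simp add: mpow_def pointwise)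
  qed
  then show ?thesis by (simp add: mpow_def)
qed

text \<open>The cotangent space has dimension n, so the linear parts of v, Fv, ..., F^n v are
  dependent; the coefficients of a relation are those of \<open>q\<close>.\<close>

lemma cotangent_vector_annihilator:
  fixes v :: "'n::finite fps_n"
  assumes "filtered F" "v \<in> mpow (Suc 0)"
  obtains q where "q \<noteq> 0" "pact F q v \<in> mpow (Suc (Suc 0))"
proof -
  define T where "T = range (fps_n_var :: 'n \<Rightarrow> 'n fps_n)"
  define w where "w = (\<lambda>j. linpart ((F ^^ j) v))"
  have "w j \<in> fps_n.span T" for j
    unfolding w_def linpart_def T_def
    by (intro fps_n.span_sum fps_n.span_scale fps_n.span_base) auto
  then obtain c where c: "\<exists>j\<le>card T. c j \<noteq> 0" "(\<Sum>j\<le>card T. scale (c j) (w j)) = 0"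
    using span_linear_relation[of T w] by (auto simp: T_def)
  define q where "q = (\<Sum>j\<le>card T. monom (c j) j)"
  have coeff: "coeff q i = (if i \<le> card T then c i else 0)" for i
    by (simp add: q_def coeff_sum)
  have "q \<noteq> 0" using c(1) coeff by (metis coeff_0)
  have "degree q \<le> card T" by (rule degree_le) (simp add: coeff)
  then have pact: "pact F q v = (\<Sum>j\<le>card T. scale (c j) ((F ^^ j) v))"
    by (simp add: pact_eq coeff)
  have "linpart (pact F q v) = 0"
    unfolding pact linpart_sum_scale using c(2) by (simp add: w_def)
  then have "pact F q v \<in> mpow (Suc (Suc 0))"
    using linpart_cong[OF pact_mpow[OF assms], of q] by simp
  with \<open>q \<noteq> 0\<close> show ?thesis by (rule that)
qed

text \<open>The annihilators of the n variables are multiplied. Powers of X are then divided out,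
  which is legitimate because \<open>F\<close> reflects the filtration; the roots left over are
  nonzero and can serve as torus coordinates.\<close>

lemma cotangent_annihilator:
  fixes F :: "'n::finite fps_n \<Rightarrow> 'n fps_n"
  assumes F: "F \<in> formal_diff"
  obtains q where "q \<noteq> 0" "poly q 0 \<noteq> 0" "\<And>f. f \<in> mpow (Suc 0) \<Longrightarrow> pact F q f \<in> mpow (Suc (Suc 0))"
proof -
  have filt: "filtered F" using F by (rule formal_diff_filtered)
  then have lin: "lin F" by (rule filtered_lin)
  have "\<forall>i. \<exists>q. q \<noteq> 0 \<and> pact F q (fps_n_var i) \<in> mpow (Suc (Suc 0))"
    using cotangent_vector_annihilator[OF filt fps_n_var_mpow] by metis
  then obtain p where p: "\<And>i. p i \<noteq> 0" "\<And>i. pact F (p i) (fps_n_var i) \<in> mpow (Suc (Suc 0))"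
    by metis
  define P where "P = (\<Prod>i\<in>UNIV. p i)"
  have "P \<noteq> 0" using p(1) by (simp add: P_def)
  have P: "pact F P f \<in> mpow (Suc (Suc 0))" if f: "f \<in> mpow (Suc 0)" for f
  proof -
    have "p i dvd P" for i unfolding P_def by (rule dvd_prodI) auto
    then have "pact F P (fps_n_var i) \<in> mpow (Suc (Suc 0))" for i
      using pact_dvd_mpow[OF filt] p(2) by blast
    then have "pact F P (linpart f) \<in> mpow (Suc (Suc 0))"
      unfolding linpart_def
      by (simp add: lin_sum lin_scale filtered_lin[OF filtered_pact[OF filt]] mpow_sum mpow_scale)
    with filtered_cong[OF filtered_pact[OF filt] linpart_cong[OF f]] show ?thesis
      by (rule mpow_cong_mem)
  qed
  define m where "m = order 0 P"
  obtain q where q: "P = [:- 0, 1:] ^ m * q" "\<not> [:- 0, 1:] dvd q"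
    using order_decomp[OF \<open>P \<noteq> 0\<close>, of 0] m_def by blast
  have red: "g \<in> mpow k" if "pact F ([:- 0, 1:] ^ j) g \<in> mpow k" for g j k
    using that
  proof (induction j)
    case (Suc j)
    then have "F (pact F ([:- 0, 1:] ^ j) g) \<in> mpow k"
      by (simp only: power_Suc pact_mult[OF lin] pact_linear_factor[OF lin]) simp
    with Suc.IH formal_diff_reflects_mpow[OF F] show ?case by blast
  qed simp
  have "poly q 0 \<noteq> 0" using q(2) by (simp add: poly_eq_0_iff_dvd)
  moreover have "pact F q f \<in> mpow (Suc (Suc 0))" if "f \<in> mpow (Suc 0)" for f
    using P[OF that] unfolding q(1) pact_mult[OF lin] by (rule red)
  ultimately show ?thesis using that[of q] by fastforce
qed

section \<open>Monomials and characters of a finitely generated monoid\<close>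

definition lmon :: "nat \<Rightarrow> (nat \<Rightarrow> complex) \<Rightarrow> (nat \<Rightarrow> nat) \<Rightarrow> complex" where
  "lmon d t a = (\<Prod>j<d. t j ^ a j)"

lemma lmon_mult: "lmon d (\<lambda>j. s j * t j) a = lmon d s a * lmon d t a"
  by (simp add: lmon_def power_mult_distrib prod.distrib)

lemma lmon_inverse: "lmon d (\<lambda>j. inverse (t j)) a = inverse (lmon d t a)"
  by (simp add: lmon_def power_inverse prod_inversef[symmetric] comp_def)

lemma lmon_power_int: "lmon d (\<lambda>j. t j powi n) a = lmon d t a powi n"
proof -
  have "(t j powi n) ^ a j = (t j ^ a j) powi n" for j
    by (metis power_int_mult power_int_of_nat mult.commute)
  then show ?thesis
    unfolding lmon_def by (induction d) (auto simp: power_int_mult_distrib)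
qed

lemma lmon_add: "lmon d t (\<lambda>j. a j + b j) = lmon d t a * lmon d t b"
  by (simp add: lmon_def power_add prod.distrib)

lemma lmon_0: "lmon d t (\<lambda>_. 0) = 1"
  by (simp add: lmon_def)

lemma lmon_nonzero: "(\<And>j. j < d \<Longrightarrow> t j \<noteq> 0) \<Longrightarrow> lmon d t a \<noteq> 0"
  by (simp add: lmon_def)

lemma lmon_unit: "i < d \<Longrightarrow> lmon d t (\<lambda>j. if j = i then 1 else 0) = t i"
  by (simp add: lmon_def if_distrib prod.delta cong: if_cong)

text \<open>The diagonalisable group of all characters of the multiplicative monoid generated by
  \<open>l 0, \<dots>, l (d - 1)\<close>, as a closed subgroup of the torus.\<close>

definition tor :: "nat \<Rightarrow> (nat \<Rightarrow> complex) \<Rightarrow> (nat \<Rightarrow> complex) set" where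
  "tor d l = {t. (\<forall>j<d. t j \<noteq> 0) \<and> (\<forall>a b. lmon d l a = lmon d l b \<longrightarrow> lmon d t a = lmon d t b)}"

lemma tor_mult: "s \<in> tor d l \<Longrightarrow> t \<in> tor d l \<Longrightarrow> (\<lambda>j. s j * t j) \<in> tor d l"
  unfolding tor_def mem_Collect_eq lmon_mult by (metis mult_eq_0_iff)

lemma tor_inverse: "t \<in> tor d l \<Longrightarrow> (\<lambda>j. inverse (t j)) \<in> tor d l"
  unfolding tor_def mem_Collect_eq lmon_inverse by (metis inverse_zero_imp_zero)

lemma tor_one: "(\<lambda>_. 1) \<in> tor d l"
  by (simp add: tor_def lmon_def)

text \<open>This point corresponds to the character raising to the power n, that is, to the
  semisimple part of the n-th iterate.\<close>

lemma tor_power_int: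
  assumes "\<And>j. j < d \<Longrightarrow> l j \<noteq> 0"
  shows "(\<lambda>j. l j powi n) \<in> tor d l"
  unfolding tor_def mem_Collect_eq lmon_power_int using assms by (metis power_int_eq_0_iff)

lemma tor_cong: "s \<in> tor d l \<Longrightarrow> (\<And>j. j < d \<Longrightarrow> s j = t j) \<Longrightarrow> t \<in> tor d l"
proof -
  assume s: "s \<in> tor d l" and eq: "\<And>j. j < d \<Longrightarrow> s j = t j"
  have "lmon d s a = lmon d t a" for a unfolding lmon_def by (rule prod.cong) (auto simp: eq)
  with s show ?thesis unfolding tor_def mem_Collect_eq using eq by metis
qed

text \<open>The character taking the value \<open>t j\<close> at \<open>l j\<close>. For
  \<open>t\<close> in \<open>tor d l\<close> the selected exponent does not matter. It depends only
  on d, l and \<mu>, so evaluation is multiplicative in \<open>t\<close> for all tuples.\<close>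

definition eval_char :: "nat \<Rightarrow> (nat \<Rightarrow> complex) \<Rightarrow> (nat \<Rightarrow> complex) \<Rightarrow> complex \<Rightarrow> complex" where
  "eval_char d l t \<mu> = lmon d t (SOME a. lmon d l a = \<mu>)"

lemma eval_char_lmon:
  assumes "t \<in> tor d l" shows "eval_char d l t (lmon d l a) = lmon d t a"
proof -
  have "lmon d l (SOME b. lmon d l b = lmon d l a) = lmon d l a" by (rule someI[of "\<lambda>b. lmon d l b = lmon d l a" a]) (rule refl)
  then show ?thesis using assms unfolding eval_char_def tor_def by blast
qed

lemma eval_char_mult: "eval_char d l (\<lambda>j. s j * t j) \<mu> = eval_char d l s \<mu> * eval_char d l t \<mu>"
  by (simp add: eval_char_def lmon_mult)

lemma tendsto_lmon:
  assumes "\<And>j. j < d \<Longrightarrow> ((\<lambda>x. T x j) \<longlongrightarrow> t j) \<F>"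
  shows "((\<lambda>x. lmon d (T x) a) \<longlongrightarrow> lmon d t a) \<F>"
  unfolding lmon_def using assms by (intro tendsto_prod tendsto_power) auto

lemma is_poly_tendsto: "is_poly h \<Longrightarrow> (Z \<longlongrightarrow> z) \<F> \<Longrightarrow> ((\<lambda>x. h (Z x)) \<longlongrightarrow> h z) \<F>"
  unfolding is_poly_def using tendsto_poly by fastforce

lemma jet_entry_comp:
  assumes "filtered \<phi>"
  shows "jet_entry (\<phi> \<circ> \<psi>) \<alpha> \<beta> = (\<Sum>\<gamma> | mdeg \<gamma> \<le> mdeg \<alpha>. jet_entry \<psi> \<gamma> \<beta> * jet_entry \<phi> \<alpha> \<gamma>)"
  using filtered_apply_eq[OF assms, of "\<psi> (fps_n_monom \<beta>)" \<alpha>] by (simp add: jet_entry_def)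

text \<open>This collects what is needed from a single generator: \<open>t\<close> drives the
  semisimple part and \<open>z\<close> the unipotent one. The commutation clause is what lets
  different generators be combined. Continuity is stated along arbitrary filters and simultaneously
  in \<open>t\<close> and \<open>z\<close>.\<close>

definition is_flow :: "nat \<Rightarrow> (nat \<Rightarrow> complex) \<Rightarrow> ('n::finite fps_n \<Rightarrow> 'n fps_n) \<Rightarrow>
    ((nat \<Rightarrow> complex) \<Rightarrow> complex \<Rightarrow> 'n fps_n \<Rightarrow> 'n fps_n) \<Rightarrow> bool" where
  "is_flow d l F R \<longleftrightarrow>
    (\<forall>t z. t \<in> tor d l \<longrightarrow> R t z \<in> formal_diff) \<and>
    (\<forall>t z. filtered (R t z)) \<and>
    (\<forall>s t z w. R (\<lambda>j. s j * t j) (z + w) = R s z \<circ> R t w) \<and>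
    (\<forall>\<psi> t z. filtered \<psi> \<longrightarrow> \<psi> \<circ> F = F \<circ> \<psi> \<longrightarrow> \<psi> \<circ> R t z = R t z \<circ> \<psi>) \<and>
    R l 1 = F \<and>
    (\<forall>(\<F> :: complex mat filter) T t Z z \<alpha> \<beta>.
      (\<forall>j<d. ((\<lambda>x. T x j) \<longlongrightarrow> t j) \<F>) \<longrightarrow> (Z \<longlongrightarrow> z) \<F> \<longrightarrow>
      ((\<lambda>x. jet_entry (R (T x) (Z x)) \<alpha> \<beta>) \<longlongrightarrow> jet_entry (R t z) \<alpha> \<beta>) \<F>)"

lemma flow_exists:
  fixes F :: "'n::finite fps_n \<Rightarrow> 'n fps_n" and l :: "nat \<Rightarrow> complex"
  assumes F: "F \<in> formal_diff" and l: "\<And>j. j < d \<Longrightarrow> l j \<noteq> 0"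
    and q: "q \<noteq> 0" "\<And>\<mu>. poly q \<mu> = 0 \<Longrightarrow> \<mu> \<in> l ` {..<d}"
      "\<And>f. f \<in> mpow (Suc 0) \<Longrightarrow> pact F q f \<in> mpow (Suc (Suc 0))"
  shows "\<exists>R. is_flow d l F R"
proof -
  define E where "E = range (lmon d l)"
  interpret spectral F E q
  proof
    show "1 \<in> E" unfolding E_def using lmon_0 by (metis rangeI)
    show "\<mu> * \<nu> \<in> E" if \<mu>\<nu>: "\<mu> \<in> E" "\<nu> \<in> E" for \<mu> \<nu>
    proof -
      obtain a b where "\<mu> = lmon d l a" "\<nu> = lmon d l b" using \<mu>\<nu> unfolding E_def by blast
      then have "\<mu> * \<nu> = lmon d l (\<lambda>j. a j + b j)" by (simp add: lmon_add)
      then show ?thesis unfolding E_def by blast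
    qed
    show "0 \<notin> E" unfolding E_def using lmon_nonzero[of d l] l by fastforce
    show "\<mu> \<in> E" if root: "poly q \<mu> = 0" for \<mu>
    proof -
      obtain i where "i < d" "\<mu> = l i" using q(2)[OF root] by auto
      then have "\<mu> = lmon d l (\<lambda>j. if j = i then 1 else 0)" by (simp add: lmon_unit)
      then show ?thesis unfolding E_def by blast
    qed
  qed (use F q in auto)
  interpret u: unipotent unip
    by unfold_locales (rule unip_formal_diff, rule unip_nilpotent)
  define R where "R = (\<lambda>t z. semi (eval_char d l t) \<circ> u.upow z)"
  have tor_char: "character (eval_char d l t)" if t: "t \<in> tor d l" for t
  proof -
    have "eval_char d l t 1 = 1" using eval_char_lmon[OF t, of "\<lambda>_. 0"] by (simp add: lmon_0)
    moreover have "eval_char d l t (lmon d l a * lmon d l b) =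
        eval_char d l t (lmon d l a) * eval_char d l t (lmon d l b)" for a b
      unfolding lmon_add[symmetric] eval_char_lmon[OF t] ..
    moreover have "lmon d t a \<noteq> 0" for a using t unfolding tor_def by (intro lmon_nonzero) blast
    ultimately show ?thesis unfolding character_def unfolding E_def by (auto simp: eval_char_lmon[OF t])
  qed
  have semi_self: "semi \<chi> \<circ> F = F \<circ> semi \<chi>" for \<chi>
    using semi_commute[OF filt] by simp
  show ?thesis
    unfolding is_flow_def
  proof (intro exI[of _ R] conjI allI impI)
    show "R t z \<in> formal_diff" if "t \<in> tor d l" for t z
      unfolding R_def by (intro formal_diff_comp semi_formal_diff u.upow_formal_diff tor_char that)
    show "filtered (R t z)" for t z
      unfolding R_def by (intro filtered_comp filtered_semi u.filtered_upow)
    show "R (\<lambda>j. s j * t j) (z + w) = R s z \<circ> R t w" for s t z w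
    proof -
      have "semi (eval_char d l t) \<circ> u.upow z = u.upow z \<circ> semi (eval_char d l t)"
        by (rule u.upow_commute[OF filtered_semi unip_commute[OF filtered_semi semi_self]])
      then have "R s z \<circ> R t w =
          (semi (eval_char d l s) \<circ> semi (eval_char d l t)) \<circ> (u.upow z \<circ> u.upow w)"
        unfolding R_def by (metis comp_assoc)
      then show ?thesis unfolding semi_comp u.upow_add R_def
        by (simp add: eval_char_mult[abs_def])
    qed
    show "\<psi> \<circ> R t z = R t z \<circ> \<psi>" if "filtered \<psi>" "\<psi> \<circ> F = F \<circ> \<psi>" for \<psi> t z
      unfolding R_def using semi_commute[OF that] u.upow_commute[OF that(1) unip_commute[OF that]]
      by (metis comp_assoc)
    \<comment> \<open>The point \<open>l\<close> gives the inclusion of \<open>E\<close> into C,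
      whose operator is the semisimple part of \<open>F\<close>; time 1 supplies the unipotent
      part.\<close>
    have "l \<in> tor d l" using l by (simp add: tor_def)
    then have "semi (eval_char d l l) = semi (\<lambda>\<mu>. \<mu>)"
      by (intro semi_cong) (auto simp: E_def eval_char_lmon)
    then show "R l 1 = F" unfolding R_def u.upow_1 using semi_unip by simp
    \<comment> \<open>Each entry is a finite sum of products of a monomial in the torus coordinates
      and a polynomial in \<open>z\<close>.\<close>
    show "((\<lambda>x. jet_entry (R (T x) (Z x)) \<alpha> \<beta>) \<longlongrightarrow> jet_entry (R t z) \<alpha> \<beta>) \<F>"
      if "\<forall>j<d. ((\<lambda>x. T x j) \<longlongrightarrow> t j) \<F>" "(Z \<longlongrightarrow> z) \<F>"
      for \<F> :: "complex mat filter" and T t Z z \<alpha> \<beta>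
      unfolding R_def jet_entry_comp[OF filtered_semi] jet_entry_semi eval_char_def
      by (intro tendsto_sum tendsto_mult tendsto_const tendsto_lmon that(1)[rule_format])
        (auto simp: jet_entry_def intro: is_poly_tendsto[OF u.is_poly_upow that(2)])
  qed
qed

section \<open>A diagonalisable group times a vector group as a matrix group\<close>

text \<open>The group \<open>\<complex>\<^bsup>m-1\<^esup> \<times> (\<complex>\<^sup>*)\<^bsup>n-m\<^esup>\<close>: additive coordinates in row 0, multiplicative ones on the
  diagonal from position \<open>m\<close> onwards.\<close>

definition tmat :: "nat \<Rightarrow> nat \<Rightarrow> (nat \<Rightarrow> complex) \<Rightarrow> (nat \<Rightarrow> complex) \<Rightarrow> complex mat" where
  "tmat m n z t = mat n n (\<lambda>(i, j). if i = j then (if i < m then 1 else t i)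
     else if i = 0 \<and> j < m then z j else 0)"

lemma tmat_carrier: "tmat m n z t \<in> carrier_mat n n"
  by (simp add: tmat_def)

lemma tmat_entry:
  "i < n \<Longrightarrow> j < n \<Longrightarrow> tmat m n z t $$ (i, j) =
    (if i = j then (if i < m then 1 else t i) else if i = 0 \<and> j < m then z j else 0)"
  by (simp add: tmat_def)

text \<open>The right factor is arbitrary so that it can also be the inverse of a matrix not yet
  known to lie in the group.\<close>

lemma tmat_mult_entry:
  assumes "B \<in> carrier_mat n n" "i < n" "j < n"
  shows "(tmat m n z t * B) $$ (i, j) = (if i < m then 1 else t i) * B $$ (i, j) +
    (if i = 0 then (\<Sum>k\<in>{1..<min m n}. z k * B $$ (k, j)) else 0)"
proof -
  let ?D = "if i < m then 1 else t i"
  have "(tmat m n z t * B) $$ (i, j) = (\<Sum>k\<in>{0..<n}. tmat m n z t $$ (i, k) * B $$ (k, j))"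
    using assms tmat_carrier[of m n z t] by (simp add: scalar_prod_def)
  also have "\<dots> = (\<Sum>k\<in>{0..<n}. (if i = k then ?D * B $$ (i, j) else 0) +
      (if i = 0 \<and> k \<in> {1..<min m n} then z k * B $$ (k, j) else 0))"
    using assms by (intro sum.cong) (auto simp: tmat_entry)
  also have "\<dots> = ?D * B $$ (i, j) +
      (\<Sum>k\<in>{0..<n}. if i = 0 \<and> k \<in> {1..<min m n} then z k * B $$ (k, j) else 0)"
    using assms by (simp add: sum.distrib sum.delta)
  also have "(\<Sum>k\<in>{0..<n}. if i = 0 \<and> k \<in> {1..<min m n} then z k * B $$ (k, j) else 0) =
      (if i = 0 then (\<Sum>k\<in>{1..<min m n}. z k * B $$ (k, j)) else 0)"
    by (auto intro: sum.mono_neutral_cong_right)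
  finally show ?thesis .
qed

text \<open>The additive coordinates sit in columns where the diagonal is 1, and
  \<open>0 < m\<close> puts a 1 in the corner; hence row 0 adds without interference from the
  torus.\<close>

lemma tmat_mult:
  assumes "0 < m"
  shows "tmat m n z t * tmat m n z' t' = tmat m n (\<lambda>j. z j + z' j) (\<lambda>j. t j * t' j)"
proof (rule eq_matI)
  fix i j assume "i < dim_row (tmat m n (\<lambda>j. z j + z' j) (\<lambda>j. t j * t' j))"
    "j < dim_col (tmat m n (\<lambda>j. z j + z' j) (\<lambda>j. t j * t' j))"
  then have ij: "i < n" "j < n" by (auto simp: tmat_def)
  have "(\<Sum>k\<in>{1..<min m n}. z k * tmat m n z' t' $$ (k, j)) =
      (\<Sum>k\<in>{1..<min m n}. if k = j then z j else 0)"
    using ij by (intro sum.cong) (auto simp: tmat_entry)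
  also have "\<dots> = (if 0 < j \<and> j < m then z j else 0)" using ij by (simp add: sum.delta)
  finally show "(tmat m n z t * tmat m n z' t') $$ (i, j) =
      tmat m n (\<lambda>j. z j + z' j) (\<lambda>j. t j * t' j) $$ (i, j)"
    using ij assms by (simp only: tmat_mult_entry[OF tmat_carrier]) (auto simp: tmat_entry)
qed (simp_all add: tmat_def)

lemma tmat_cong:
  "(\<And>j. 0 < j \<Longrightarrow> j < m \<Longrightarrow> z j = z' j) \<Longrightarrow> (\<And>j. m \<le> j \<Longrightarrow> j < n \<Longrightarrow> t j = t' j) \<Longrightarrow>
    tmat m n z t = tmat m n z' t'"
  by (rule eq_matI) (auto simp: tmat_def)

lemma tmat_one: "tmat m n (\<lambda>_. 0) (\<lambda>_. 1) = 1\<^sub>m n"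
  by (rule eq_matI) (auto simp: tmat_def)

lemma polyfun_minus: "P \<in> polyfun N \<Longrightarrow> Q \<in> polyfun N \<Longrightarrow> (\<lambda>A. P A - Q A) \<in> polyfun N"
  using polyfun.add[OF _ polyfun.mult[OF polyfun.const[of "- 1"]], of P N Q] by simp

lemma polyfun_power: "P \<in> polyfun N \<Longrightarrow> (\<lambda>A. P A ^ k) \<in> polyfun N"
  by (induction k) (auto intro: polyfun.const polyfun.mult)

lemma polyfun_prod: "(\<And>i. i \<in> I \<Longrightarrow> P i \<in> polyfun N) \<Longrightarrow> (\<lambda>A. \<Prod>i\<in>I. P i A) \<in> polyfun N"
  by (induction I rule: infinite_finite_induct) (auto intro: polyfun.const polyfun.mult)

text \<open>There are p consecutive diagonal blocks of length d, one copy of the character group for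
  each generator, all with the same relations; the additive coordinates are unconstrained.\<close>

definition tvg :: "nat \<Rightarrow> nat \<Rightarrow> nat \<Rightarrow> (nat \<Rightarrow> complex) \<Rightarrow> complex mat set" where
  "tvg m p d l = {tmat m (m + p * d) z t | z t. \<forall>i<p. (\<lambda>j. t (m + i * d + j)) \<in> tor d l}"

lemma block_index_less: "i < p \<Longrightarrow> j < d \<Longrightarrow> m + i * d + j < m + p * (d::nat)"
proof -
  assume "i < p" "j < d"
  have "i * d + j < Suc i * d" using \<open>j < d\<close> by simp
  also have "\<dots> \<le> p * d" using \<open>i < p\<close> by (intro mult_le_mono1) simp
  finally show ?thesis by simp
qed

lemma block_indexE:
  assumes "m \<le> k" "k < m + p * (d::nat)"
  obtains i j where "i < p" "j < d" "k = m + i * d + j"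
proof
  have "d > 0" using assms by (cases d) auto
  then show "(k - m) mod d < d" by simp
  show "(k - m) div d < p" using assms \<open>d > 0\<close> by (simp add: less_mult_imp_div_less)
  show "k = m + (k - m) div d * d + (k - m) mod d" using assms by simp
qed

lemma abelian_linear_algebraic_group_tvg:
  assumes "0 < m"
  shows "abelian_linear_algebraic_group (m + p * d) (tvg m p d l)"
proof -
  let ?N = "m + p * d" and ?G = "tvg m p d l"
  let ?T = "\<lambda>A i j. A $$ (m + i * d + j, m + i * d + j) :: complex"
  \<comment> \<open>The first two families prescribe the shape of \<open>tmat\<close>; the third
    imposes the binomial relations of each block.\<close>
  define S :: "(complex mat \<Rightarrow> complex) set" where
    "S = {\<lambda>A. A $$ (i, i) - 1 | i. i < m} \<union>
      {\<lambda>A. A $$ (i, j) | i j. i < ?N \<and> j < ?N \<and> i \<noteq> j \<and> \<not> (i = 0 \<and> j < m)} \<union>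
      {\<lambda>A. lmon d (?T A i) a - lmon d (?T A i) b | i a b. i < p \<and> lmon d l a = lmon d l b}"
  have S_poly: "S \<subseteq> polyfun ?N"
  proof -
    have "(\<lambda>A. lmon d (?T A i) a) \<in> polyfun ?N" if "i < p" for i a
      unfolding lmon_def using that block_index_less[of i p _ d m]
      by (intro polyfun_prod polyfun_power polyfun.entry) auto
    then show ?thesis unfolding S_def
      by (auto intro!: polyfun_minus polyfun.const polyfun.entry)
  qed
  have closed: "A * B \<in> ?G" if AB: "A \<in> ?G" "B \<in> ?G" for A B
  proof -
    obtain z t z' t' where zt: "A = tmat m ?N z t" "\<And>i. i < p \<Longrightarrow> (\<lambda>j. t (m + i * d + j)) \<in> tor d l"
        "B = tmat m ?N z' t'" "\<And>i. i < p \<Longrightarrow> (\<lambda>j. t' (m + i * d + j)) \<in> tor d l"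
      using AB unfolding tvg_def by blast
    show ?thesis
      unfolding zt(1,3) tmat_mult[OF assms] tvg_def using tor_mult[OF zt(2,4)] by blast
  qed
  have comm: "A * B = B * A" if "A \<in> ?G" "B \<in> ?G" for A B
    using that assms unfolding tvg_def by (auto simp: tmat_mult add.commute mult.commute)
  have one: "1\<^sub>m ?N \<in> ?G"
    unfolding tvg_def tmat_one[symmetric, of ?N m] using tor_one by blast
  have inverse: "\<exists>B\<in>?G. A * B = 1\<^sub>m ?N" if A: "A \<in> ?G" for A
  proof -
    obtain z t where zt: "A = tmat m ?N z t" "\<And>i. i < p \<Longrightarrow> (\<lambda>j. t (m + i * d + j)) \<in> tor d l"
      using A unfolding tvg_def by blast
    let ?B = "tmat m ?N (\<lambda>j. - z j) (\<lambda>j. inverse (t j))"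
    have "?B \<in> ?G" unfolding tvg_def using tor_inverse[OF zt(2)] by blast
    moreover have "t k \<noteq> 0" if k: "m \<le> k" "k < ?N" for k
    proof -
      obtain i j where "i < p" "j < d" "k = m + i * d + j" using block_indexE[OF k] .
      then show ?thesis using zt(2)[of i] by (auto simp: tor_def)
    qed
    then have "A * ?B = 1\<^sub>m ?N"
      unfolding zt(1) tmat_mult[OF assms] tmat_one[symmetric, of ?N m] by (intro tmat_cong) auto
    ultimately show ?thesis by blast
  qed
  have carrier: "?G \<subseteq> carrier_mat ?N ?N" unfolding tvg_def by (auto simp: tmat_carrier)
  have invertible: "invertible_mat A" if A: "A \<in> ?G" for A
  proof -
    obtain B where B: "B \<in> ?G" "A * B = 1\<^sub>m ?N" using inverse[OF A] by blast
    then have "B * A = 1\<^sub>m ?N" using comm[OF A B(1)] by simp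
    with A B carrier show ?thesis unfolding invertible_mat_def inverts_mat_def by fastforce
  qed
  have "?G = {A \<in> carrier_mat ?N ?N. invertible_mat A \<and> (\<forall>P\<in>S. P A = 0)}"
  proof (intro equalityI subsetI)
    fix A assume A: "A \<in> ?G"
    then obtain z t where zt: "A = tmat m ?N z t" "\<And>i. i < p \<Longrightarrow> (\<lambda>j. t (m + i * d + j)) \<in> tor d l"
      unfolding tvg_def by blast
    have T: "lmon d (?T A i) a = lmon d (\<lambda>j. t (m + i * d + j)) a" if "i < p" for i a
      unfolding lmon_def zt(1) using block_index_less[OF that]
      by (intro prod.cong) (auto simp: tmat_entry)
    have "P A = 0" if "P \<in> S" for P
      using that unfolding S_def
    proof (elim UnE)
      assume "P \<in> {\<lambda>A. lmon d (?T A i) a - lmon d (?T A i) b | i a b. i < p \<and> lmon d l a = lmon d l b}"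
      then obtain i a b where iab: "P = (\<lambda>A. lmon d (?T A i) a - lmon d (?T A i) b)"
        "i < p" "lmon d l a = lmon d l b" by blast
      have "lmon d (\<lambda>j. t (m + i * d + j)) a = lmon d (\<lambda>j. t (m + i * d + j)) b"
        using zt(2)[OF iab(2)] iab(3) unfolding tor_def by blast
      then show ?thesis by (simp add: iab(1) T[OF iab(2)])
    qed (auto simp: zt(1) tmat_entry)
    with A carrier invertible show "A \<in> {A \<in> carrier_mat ?N ?N. invertible_mat A \<and> (\<forall>P\<in>S. P A = 0)}"
      by blast
  next
    fix A assume "A \<in> {A \<in> carrier_mat ?N ?N. invertible_mat A \<and> (\<forall>P\<in>S. P A = 0)}"
    then have A: "A \<in> carrier_mat ?N ?N" "invertible_mat A" and P: "\<And>P. P \<in> S \<Longrightarrow> P A = 0" by auto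
    have diag: "A $$ (i, i) = 1" if "i < m" for i
    proof -
      have "(\<lambda>A. A $$ (i, i) - 1) \<in> S" using that unfolding S_def by blast
      from P[OF this] show ?thesis by simp
    qed
    have off: "A $$ (i, j) = 0" if "i < ?N" "j < ?N" "i \<noteq> j" "\<not> (i = 0 \<and> j < m)" for i j
      using P[of "\<lambda>A. A $$ (i, j)"] that unfolding S_def by blast
    have rel: "lmon d (?T A i) a = lmon d (?T A i) b" if "i < p" "lmon d l a = lmon d l b" for i a b
    proof -
      have "(\<lambda>A. lmon d (?T A i) a - lmon d (?T A i) b) \<in> S" using that unfolding S_def by blast
      from P[OF this] show ?thesis by simp
    qed
    have eq: "A = tmat m ?N (\<lambda>j. A $$ (0, j)) (\<lambda>k. A $$ (k, k))"
      using A(1) diag off by (intro eq_matI) (auto simp: tmat_entry tmat_def)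
    obtain B where "inverts_mat A B" "inverts_mat B A"
      using A(2) unfolding invertible_mat_def by blast
    then have AB: "A * B = 1\<^sub>m ?N" "B * A = 1\<^sub>m (dim_row B)" using A(1) by (auto simp: inverts_mat_def)
    have B: "B \<in> carrier_mat ?N ?N"
      using arg_cong[OF AB(1), of dim_col] arg_cong[OF AB(2), of dim_col] A(1) by auto
    \<comment> \<open>That the torus coordinates do not vanish is not among the equations. It
      follows from invertibility: row \<open>k\<close> has only its diagonal entry, so that entry
      times the corresponding entry of the inverse is 1.\<close>
    have nz: "A $$ (k, k) \<noteq> 0" if k: "m \<le> k" "k < ?N" for k
    proof -
      have "(A * B) $$ (k, k) = A $$ (k, k) * B $$ (k, k)"
        by (subst eq) (use assms k B in \<open>simp add: tmat_mult_entry\<close>)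
      then show ?thesis using AB(1) k by auto
    qed
    have "?T A i \<in> tor d l" if "i < p" for i
      unfolding tor_def mem_Collect_eq
    proof (intro conjI allI impI)
      show "?T A i j \<noteq> 0" if "j < d" for j
        using nz block_index_less[OF \<open>i < p\<close> that] by simp
    qed (rule rel[OF that])
    then show "A \<in> ?G" unfolding tvg_def using eq by blast
  qed
  with S_poly have ex: "\<exists>S\<subseteq>polyfun ?N. ?G = {A \<in> carrier_mat ?N ?N. invertible_mat A \<and> (\<forall>P\<in>S. P A = 0)}"
    by blast
  show ?thesis
    unfolding abelian_linear_algebraic_group_def
    by (intro conjI ballI carrier one ex invertible closed inverse comm)
qed

text \<open>The entrywise neighbourhood filter of \<open>A\<close> relative to \<open>G\<close>; it
  turns \<open>mat_continuous_on\<close> into limits, to which the rules for sums and products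
  apply.\<close>

definition mat_nhds :: "nat \<Rightarrow> complex mat set \<Rightarrow> complex mat \<Rightarrow> complex mat filter" where
  "mat_nhds N G A =
    (INF \<delta>\<in>{0<..}. principal {B \<in> G. \<forall>i<N. \<forall>j<N. cmod (B $$ (i, j) - A $$ (i, j)) < \<delta>})"

lemma eventually_mat_nhds:
  "eventually P (mat_nhds N G A) \<longleftrightarrow>
    (\<exists>\<delta>>0. \<forall>B\<in>G. (\<forall>i<N. \<forall>j<N. cmod (B $$ (i, j) - A $$ (i, j)) < \<delta>) \<longrightarrow> P B)"
  unfolding mat_nhds_def
proof (subst eventually_INF_base)
  fix a b :: real assume "a \<in> {0<..}" "b \<in> {0<..}"
  then show "\<exists>x\<in>{0<..}. principal {B \<in> G. \<forall>i<N. \<forall>j<N. cmod (B $$ (i, j) - A $$ (i, j)) < x}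
      \<le> inf (principal {B \<in> G. \<forall>i<N. \<forall>j<N. cmod (B $$ (i, j) - A $$ (i, j)) < a})
         (principal {B \<in> G. \<forall>i<N. \<forall>j<N. cmod (B $$ (i, j) - A $$ (i, j)) < b})"
    by (intro bexI[of _ "min a b"]) auto
qed (auto simp: eventually_principal)

lemma mat_continuous_onI:
  "(\<And>A. A \<in> G \<Longrightarrow> (f \<longlongrightarrow> f A) (mat_nhds N G A)) \<Longrightarrow> mat_continuous_on N G f"
  unfolding mat_continuous_on_def tendsto_iff eventually_mat_nhds dist_norm by blast

lemma tendsto_mat_entry:
  "i < N \<Longrightarrow> j < N \<Longrightarrow> ((\<lambda>B. B $$ (i, j)) \<longlongrightarrow> A $$ (i, j)) (mat_nhds N G A)"
  unfolding tendsto_iff eventually_mat_nhds dist_norm by blast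

section \<open>Combining the generators\<close>

primrec flow_prod :: "(nat \<Rightarrow> 'b \<Rightarrow> 'b) \<Rightarrow> ('b \<Rightarrow> 'b) \<Rightarrow> nat \<Rightarrow> 'b \<Rightarrow> 'b" where
  "flow_prod \<phi> \<psi> 0 = \<psi>"
| "flow_prod \<phi> \<psi> (Suc i) = \<phi> i \<circ> flow_prod \<phi> \<psi> i"

lemma flow_prod_commute:
  assumes "\<And>k. k < i \<Longrightarrow> \<theta> \<circ> \<phi> k = \<phi> k \<circ> \<theta>" "\<theta> \<circ> \<psi> = \<psi> \<circ> \<theta>"
  shows "\<theta> \<circ> flow_prod \<phi> \<psi> i = flow_prod \<phi> \<psi> i \<circ> \<theta>"
  using assms(1)
proof (induction i)
  case (Suc i)
  have "\<theta> \<circ> flow_prod \<phi> \<psi> (Suc i) = (\<theta> \<circ> \<phi> i) \<circ> flow_prod \<phi> \<psi> i" by (simp add: comp_assoc)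
  also have "\<theta> \<circ> \<phi> i = \<phi> i \<circ> \<theta>" using Suc.prems by blast
  also have "\<phi> i \<circ> \<theta> \<circ> flow_prod \<phi> \<psi> i = \<phi> i \<circ> (\<theta> \<circ> flow_prod \<phi> \<psi> i)"
    by (rule comp_assoc)
  also have "\<theta> \<circ> flow_prod \<phi> \<psi> i = flow_prod \<phi> \<psi> i \<circ> \<theta>"
    using Suc.IH Suc.prems less_Suc_eq by blast
  also have "\<phi> i \<circ> (flow_prod \<phi> \<psi> i \<circ> \<theta>) = flow_prod \<phi> \<psi> (Suc i) \<circ> \<theta>"
    by (simp add: comp_assoc)
  finally show ?case .
qed (simp add: assms(2))

lemma flow_prod_formal_diff:
  assumes "\<And>k. k < i \<Longrightarrow> \<phi> k \<in> formal_diff" "\<psi> \<in> formal_diff"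
  shows "flow_prod \<phi> \<psi> i \<in> formal_diff"
  using assms by (induction i) (auto intro: formal_diff_comp)

text \<open>Both sides are multiplicative in \<open>n\<close> and agree at 1. The induction starts
  there, and surjectivity of \<open>F\<close> permits cancelling it on the right in the downward
  direction.\<close>

lemma flow_power_int:
  fixes h :: "int \<Rightarrow> 'n::finite fps_n \<Rightarrow> 'n fps_n"
  assumes R: "is_flow d l F R" and l: "\<And>j. l j \<noteq> 0"
    and h: "h 1 = F" "\<And>m n. h (m + n) = h m \<circ> h n" and F: "surj F"
  shows "R (\<lambda>j. l j powi n) (of_int n) = h n"
proof -
  have step: "R (\<lambda>j. l j powi (n + 1)) (of_int (n + 1)) = R (\<lambda>j. l j powi n) (of_int n) \<circ> F" for n
  proof -
    have "(\<lambda>j. l j powi (n + 1)) = (\<lambda>j. l j powi n * l j)"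
      using l by (simp add: power_int_add_1)
    then show ?thesis using R unfolding is_flow_def by (metis of_int_1 of_int_add)
  qed
  show ?thesis
  proof (induction n rule: int_induct[where k = 1])
    case base
    then show ?case using R h(1) unfolding is_flow_def by simp
  next
    case (step1 n)
    then show ?case using step[of n] h by simp
  next
    case (step2 n)
    have "R (\<lambda>j. l j powi (n - 1)) (of_int (n - 1)) \<circ> F = h (n - 1) \<circ> F"
      using step[of "n - 1"] step2.IH h(2)[of "n - 1" 1] h(1) by simp
    then show ?case using F by (metis surj_fun_eq)
  qed
qed

theorem theorem2p6:
  fixes p q :: nat
    and \<rho> :: "(nat \<Rightarrow> int) \<times> (nat \<Rightarrow> real) \<Rightarrow> ('n::finite fps_n \<Rightarrow> 'n fps_n)"
  assumes "lie_hom_ZR p q \<rho>"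
  shows "\<exists>N G (\<rho>' :: complex mat \<Rightarrow> ('n fps_n \<Rightarrow> 'n fps_n)).
           abelian_linear_algebraic_group N G \<and> lie_hom_mat N G \<rho>'
           \<and> \<rho> ` ZR_dom p q \<subseteq> \<rho>' ` G"
proof -
  have fd: "\<rho> x \<in> formal_diff" if "x \<in> ZR_dom p q" for x
    using assms that unfolding lie_hom_ZR_def by blast
  have hom: "\<rho> (ZR_add x y) = \<rho> x \<circ> \<rho> y" if "x \<in> ZR_dom p q" "y \<in> ZR_dom p q" for x y
    using assms that unfolding lie_hom_ZR_def by blast
  have cont: "ZR_continuous p q (\<lambda>x. jet_entry (\<rho> x) \<alpha> \<beta>)" for \<alpha> \<beta>
    using assms unfolding lie_hom_ZR_def by (meson max.cobounded1 max.cobounded2)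
  have comm: "\<rho> x \<circ> \<rho> y = \<rho> y \<circ> \<rho> x" if "x \<in> ZR_dom p q" "y \<in> ZR_dom p q" for x y
  proof -
    have "ZR_add x y = ZR_add y x" by (simp add: ZR_add_def add.commute)
    then show ?thesis using hom that by metis
  qed

  define e :: "nat \<Rightarrow> int \<Rightarrow> (nat \<Rightarrow> int) \<times> (nat \<Rightarrow> real)"
    where "e = (\<lambda>i n. ((\<lambda>j. if j = i then n else 0), (\<lambda>_. 0)))"
  have e_dom: "e i n \<in> ZR_dom p q" if "i < p" for i n using that by (auto simp: e_def ZR_dom_def)
  have e_add: "ZR_add (e i m) (e i n) = e i (m + n)" for i m n
    by (auto simp: e_def ZR_add_def)
  define F where "F = (\<lambda>i. \<rho> (e i 1))"
  have F: "F i \<in> formal_diff" if "i < p" for i unfolding F_def by (rule fd[OF e_dom[OF that]])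

  have "\<forall>i. \<exists>q. i < p \<longrightarrow> q \<noteq> 0 \<and> poly q 0 \<noteq> 0 \<and>
      (\<forall>f. f \<in> mpow (Suc 0) \<longrightarrow> pact (F i) q f \<in> mpow (Suc (Suc 0)))"
    using cotangent_annihilator[OF F] by metis
  then obtain qs where qs: "\<And>i. i < p \<Longrightarrow> qs i \<noteq> 0" "\<And>i. i < p \<Longrightarrow> poly (qs i) 0 \<noteq> 0"
    "\<And>i f. i < p \<Longrightarrow> f \<in> mpow (Suc 0) \<Longrightarrow> pact (F i) (qs i) f \<in> mpow (Suc (Suc 0))" by metis
  \<comment> \<open>A common multiple of the annihilators lets one list of eigenvalues serve every
    generator.\<close>
  define Q where "Q = (\<Prod>i<p. qs i)"
  have Q: "Q \<noteq> 0" "poly Q 0 \<noteq> 0" using qs(1,2) by (auto simp: Q_def poly_prod)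
  have "finite {\<mu>. poly Q \<mu> = 0}" using Q(1) by (rule poly_roots_finite)
  then obtain d and l' :: "nat \<Rightarrow> complex" where l': "{\<mu>. poly Q \<mu> = 0} = l' ` {i. i < d}"
    using finite_imp_nat_seg_image_inj_on by metis
  \<comment> \<open>Padding with 1 makes every \<open>l j\<close> nonzero, so that integer powers
    obey the exponent laws for all indices.\<close>
  define l where "l = (\<lambda>j. if j < d then l' j else 1)"
  have l_image: "l ` {..<d} = {\<mu>. poly Q \<mu> = 0}" unfolding l' by (auto simp: l_def)
  have l_nz: "l j \<noteq> 0" for j
    using l_image Q(2) by (cases "j < d") (auto simp: l_def)
  have "\<exists>R. is_flow d l (F i) R" if i: "i < p" for i
  proof (rule flow_exists[OF F[OF i] l_nz Q(1)])
    show "\<mu> \<in> l ` {..<d}" if "poly Q \<mu> = 0" for \<mu> using that l_image by blast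
    have "qs i dvd Q" unfolding Q_def using i by (intro dvd_prodI) auto
    then show "pact (F i) Q f \<in> mpow (Suc (Suc 0))" if "f \<in> mpow (Suc 0)" for f
      using pact_dvd_mpow[OF formal_diff_filtered[OF F[OF i]]] qs(3)[OF i that] by blast
  qed
  then obtain R where R: "\<And>i. i < p \<Longrightarrow> is_flow d l (F i) (R i)" by metis

  \<comment> \<open>Row 0 holds the corner entry 1, then p times for the unipotent flows, then q
    coordinates for the real factor.\<close>
  define m where "m = 1 + p + q"
  define N where "N = m + p * d"
  define G where "G = tvg m p d l"
  define tc where "tc = (\<lambda>(A::complex mat) i j. if j < d then A $$ (m + i * d + j, m + i * d + j) else 1)"
  define zc where "zc = (\<lambda>(A::complex mat) i. A $$ (0, 1 + i))"
  \<comment> \<open>The integer part is zero because the flows take care of the generators of Z^p;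
    the real part maps C^q homomorphically onto R^q.\<close>
  define wc :: "complex mat \<Rightarrow> (nat \<Rightarrow> int) \<times> (nat \<Rightarrow> real)"
    where "wc = (\<lambda>A. ((\<lambda>_. 0), (\<lambda>j. if j < q then Re (A $$ (0, 1 + p + j)) else 0)))"
  define C where "C = (\<lambda>i A. flow_prod (\<lambda>i. R i (tc A i) (zc A i)) (\<rho> (wc A)) i)"
  have C_Suc: "C (Suc i) A = R i (tc A i) (zc A i) \<circ> C i A" for i A by (simp add: C_def)
  have idx: "0 < N" "i < p \<Longrightarrow> j < d \<Longrightarrow> m + i * d + j < N" "i < p \<Longrightarrow> 1 + i < m" "j < q \<Longrightarrow> 1 + p + j < m"
    "k < m \<Longrightarrow> k < N" for i j k
    using block_index_less[of i p j d m] by (auto simp: m_def N_def)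

  have wc_dom: "wc A \<in> ZR_dom p q" for A by (auto simp: wc_def ZR_dom_def)
  have GE: "\<exists>z t. A = tmat m N z t \<and> (\<forall>i<p. (\<lambda>j. t (m + i * d + j)) \<in> tor d l)" if "A \<in> G" for A
    using that unfolding G_def tvg_def N_def by blast
  have zc_tmat: "zc (tmat m N z t) i = z (1 + i)" if "i < p" for z t i
    using that idx by (simp add: zc_def tmat_entry)
  have wc_tmat: "wc (tmat m N z t) = ((\<lambda>_. 0), (\<lambda>j. if j < q then Re (z (1 + p + j)) else 0))" for z t
    using idx by (auto simp: wc_def tmat_entry)
  have tc_tmat: "tc (tmat m N z t) i = (\<lambda>j. if j < d then t (m + i * d + j) else 1)" if "i < p" for z t i
    using that idx by (auto simp: tc_def tmat_entry)
  have tc_tor: "tc A i \<in> tor d l" if A: "A \<in> G" and i: "i < p" for A i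
  proof -
    obtain z t where zt: "A = tmat m N z t" "\<forall>i<p. (\<lambda>j. t (m + i * d + j)) \<in> tor d l"
      using GE[OF A] by blast
    show ?thesis
      unfolding zt(1) tc_tmat[OF i] by (rule tor_cong[OF zt(2)[rule_format, OF i]]) simp
  qed
  have wc_mult: "wc (A * B) = ZR_add (wc A) (wc B)"
    and coords: "i < p \<Longrightarrow> zc (A * B) i = zc A i + zc B i"
      "i < p \<Longrightarrow> tc (A * B) i = (\<lambda>j. tc A i j * tc B i j)"
    if A: "A \<in> G" "B \<in> G" for A B i
  proof -
    obtain z t z' t' where AB: "A = tmat m N z t" "B = tmat m N z' t'"
      using GE[OF A(1)] GE[OF A(2)] by blast
    have "0 < m" by (simp add: m_def)
    then have mult: "A * B = tmat m N (\<lambda>j. z j + z' j) (\<lambda>j. t j * t' j)"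
      unfolding AB by (rule tmat_mult)
    show "wc (A * B) = ZR_add (wc A) (wc B)"
      unfolding mult unfolding AB wc_tmat by (auto simp: ZR_add_def)
    show "zc (A * B) i = zc A i + zc B i" "tc (A * B) i = (\<lambda>j. tc A i j * tc B i j)" if "i < p"
      unfolding mult unfolding AB zc_tmat[OF that] tc_tmat[OF that] by auto
  qed

  have R_fd: "R i t z \<in> formal_diff" if "i < p" "t \<in> tor d l" for i t z
    using R[OF that(1)] that(2) unfolding is_flow_def by blast
  have R_filt: "filtered (R i t z)" if "i < p" for i t z
    using R[OF that] unfolding is_flow_def by blast
  have R_mult: "R i (\<lambda>j. s j * t j) (z + w) = R i s z \<circ> R i t w" if "i < p" for i s t z w
    using R[OF that] unfolding is_flow_def by blast
  have R_comm: "\<psi> \<circ> R i t z = R i t z \<circ> \<psi>" if "i < p" "filtered \<psi>" "\<psi> \<circ> F i = F i \<circ> \<psi>" for \<psi> i t z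
    using R[OF that(1)] that(2,3) unfolding is_flow_def by blast
  have R_cont: "((\<lambda>x. jet_entry (R i (T x) (Z x)) \<alpha> \<beta>) \<longlongrightarrow> jet_entry (R i t z) \<alpha> \<beta>) \<F>"
    if "i < p" "\<forall>j<d. ((\<lambda>x. T x j) \<longlongrightarrow> t j) \<F>" "(Z \<longlongrightarrow> z) \<F>"
    for i T t Z z \<alpha> \<beta> and \<F> :: "complex mat filter"
    using R[OF that(1)] that(2,3) unfolding is_flow_def by (elim conjE) blast
  have F_comm: "F i \<circ> F k = F k \<circ> F i" if "i < p" "k < p" for i k
    unfolding F_def using comm e_dom that by blast

  have C_fd: "C i A \<in> formal_diff" if "A \<in> G" "i \<le> p" for i A
    unfolding C_def using that by (intro flow_prod_formal_diff R_fd tc_tor fd wc_dom) auto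
  have C_F: "F k \<circ> C i A = C i A \<circ> F k" if "i \<le> p" "k < p" for i k A
    unfolding C_def
  proof (rule flow_prod_commute)
    show "F k \<circ> R j (tc A j) (zc A j) = R j (tc A j) (zc A j) \<circ> F k" if "j < i" for j
      using that \<open>i \<le> p\<close> \<open>k < p\<close> by (intro R_comm formal_diff_filtered F F_comm) auto
    show "F k \<circ> \<rho> (wc A) = \<rho> (wc A) \<circ> F k"
      unfolding F_def using comm e_dom wc_dom \<open>k < p\<close> by blast
  qed
  have C_hom: "C i (A * B) = C i A \<circ> C i B" if A: "A \<in> G" "B \<in> G" and "i \<le> p" for i A B
    using \<open>i \<le> p\<close>
  proof (induction i)
    case 0
    then show ?case by (simp add: C_def wc_mult[OF A] hom[OF wc_dom wc_dom])
  next
    case (Suc i)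
    then have i: "i < p" "i \<le> p" by auto
    let ?RA = "R i (tc A i) (zc A i)" and ?RB = "R i (tc B i) (zc B i)"
    have "C (Suc i) (A * B) = (?RA \<circ> ?RB) \<circ> (C i A \<circ> C i B)"
      by (simp only: C_Suc Suc.IH[OF i(2)] coords[OF A i(1)] R_mult[OF i(1)])
    also have "\<dots> = ?RA \<circ> (?RB \<circ> C i A) \<circ> C i B" by (simp add: comp_assoc)
    \<comment> \<open>The partial product \<open>C i A\<close> commutes with \<open>F i\<close>, and
      the flow of \<open>F i\<close> commutes with every filtered map that does.\<close>
    also have "?RB \<circ> C i A = C i A \<circ> ?RB"
      using R_comm[OF i(1) formal_diff_filtered[OF C_fd[OF A(1) i(2)]]] C_F[OF i(2,1)] by metis
    also have "?RA \<circ> (C i A \<circ> ?RB) \<circ> C i B = C (Suc i) A \<circ> C (Suc i) B"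
      by (simp only: C_Suc comp_assoc)
    finally show ?case .
  qed
  have C_cont: "((\<lambda>B. jet_entry (C i B) \<alpha> \<beta>) \<longlongrightarrow> jet_entry (C i A) \<alpha> \<beta>) (mat_nhds N G A)"
    if "A \<in> G" "i \<le> p" for i A \<alpha> \<beta>
    using \<open>i \<le> p\<close>
  proof (induction i arbitrary: \<alpha> \<beta>)
    case 0
    show ?case
      unfolding tendsto_iff eventually_mat_nhds dist_norm
    proof (intro allI impI)
      fix \<epsilon> :: real assume "0 < \<epsilon>"
      then obtain \<delta> where \<delta>: "\<delta> > 0" "\<forall>y\<in>ZR_dom p q. fst y = fst (wc A) \<and>
          (\<forall>j<q. \<bar>snd y j - snd (wc A) j\<bar> < \<delta>) \<longrightarrow> cmod (jet_entry (\<rho> y) \<alpha> \<beta> - jet_entry (\<rho> (wc A)) \<alpha> \<beta>) < \<epsilon>"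
        using cont[of \<alpha> \<beta>] wc_dom[of A] unfolding ZR_continuous_def by blast
      \<comment> \<open>The integer part of \<open>wc\<close> is constant, and the real part does
        not increase distances, so the same \<delta> works.\<close>
      have "cmod (jet_entry (C 0 B) \<alpha> \<beta> - jet_entry (C 0 A) \<alpha> \<beta>) < \<epsilon>"
        if near: "\<forall>i<N. \<forall>j<N. cmod (B $$ (i, j) - A $$ (i, j)) < \<delta>" for B
      proof -
        have "\<bar>snd (wc B) j - snd (wc A) j\<bar> < \<delta>" if "j < q" for j
        proof -
          have "\<bar>Re (B $$ (0, 1 + p + j) - A $$ (0, 1 + p + j))\<bar> < \<delta>"
            using near idx(1) idx(5)[OF idx(4)[OF that]] abs_Re_le_cmod by (metis le_less_trans)
          then show ?thesis using that by (simp add: wc_def)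
        qed
        moreover have "fst (wc B) = fst (wc A)" by (simp add: wc_def)
        ultimately show ?thesis using \<delta>(2) wc_dom by (simp add: C_def)
      qed
      with \<delta>(1) show "\<exists>\<delta>>0. \<forall>B\<in>G. (\<forall>i<N. \<forall>j<N. cmod (B $$ (i, j) - A $$ (i, j)) < \<delta>) \<longrightarrow>
          cmod (jet_entry (C 0 B) \<alpha> \<beta> - jet_entry (C 0 A) \<alpha> \<beta>) < \<epsilon>" by blast
    qed
  next
    case (Suc i)
    then have i: "i < p" "i \<le> p" by auto
    have "((\<lambda>B. jet_entry (R i (tc B i) (zc B i)) \<alpha> \<gamma>) \<longlongrightarrow> jet_entry (R i (tc A i) (zc A i)) \<alpha> \<gamma>)
        (mat_nhds N G A)" for \<gamma>
    proof -
      have "\<forall>j<d. ((\<lambda>B. tc B i j) \<longlongrightarrow> tc A i j) (mat_nhds N G A)"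
        using idx(2)[OF i(1)] by (auto simp: tc_def intro: tendsto_mat_entry)
      moreover have "((\<lambda>B. zc B i) \<longlongrightarrow> zc A i) (mat_nhds N G A)"
        unfolding zc_def by (rule tendsto_mat_entry[OF idx(1) idx(5)[OF idx(3)[OF i(1)]]])
      ultimately show ?thesis
        by (rule R_cont[OF i(1), where T = "\<lambda>B. tc B i" and Z = "\<lambda>B. zc B i"])
    qed
    then show ?case
      by (simp only: C_Suc jet_entry_comp[OF R_filt[OF i(1)]])
        (intro tendsto_sum tendsto_mult Suc.IH[OF i(2)])
  qed

  have C_image: "\<rho> x \<in> C p ` G" if x: "x \<in> ZR_dom p q" for x
  proof -
    obtain a b where ab: "x = (a, b)" "\<forall>i\<ge>p. a i = 0" "\<forall>j\<ge>q. b j = 0"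
      using x by (auto simp: ZR_dom_def)
    define z where "z = (\<lambda>k. if k \<le> p then of_int (a (k - 1)) else complex_of_real (b (k - (1 + p))))"
    \<comment> \<open>Block \<open>i\<close> is the \<open>a i\<close>-th power of the point
      \<open>l\<close>; division with remainder by d recovers the block and the position in
      it.\<close>
    define t where "t = (\<lambda>k. l ((k - m) mod d) powi a ((k - m) div d))"
    define A where "A = tmat m N z t"
    have t: "t (m + i * d + j) = l j powi a i" if "j < d" for i j
      using that by (simp add: t_def)
    have "(\<lambda>j. t (m + i * d + j)) \<in> tor d l" for i
      by (rule tor_cong[OF tor_power_int[OF l_nz]]) (simp add: t)
    then have "A \<in> G" unfolding A_def G_def tvg_def N_def by blast
    \<comment> \<open>This is an equality of functions at all indices: from \<open>d\<close> onwards
      \<open>tc\<close> and the powers of \<open>l\<close> are both 1.\<close>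
    have tA: "tc A i = (\<lambda>j. l j powi a i)" if "i < p" for i
      unfolding A_def tc_tmat[OF that] by (auto simp: t l_def)
    have zA: "zc A i = of_int (a i)" if "i < p" for i
      unfolding A_def zc_tmat[OF that] using that by (simp add: z_def)
    have wA: "wc A = ((\<lambda>_. 0), b)" unfolding A_def wc_tmat using ab(3) by (auto simp: z_def)
    have RA: "R i (tc A i) (zc A i) = \<rho> (e i (a i))" if i: "i < p" for i
      unfolding tA[OF i] zA[OF i]
    proof (rule flow_power_int[OF R[OF i] l_nz, of "\<lambda>n. \<rho> (e i n)"])
      show "\<rho> (e i 1) = F i" by (simp add: F_def)
      show "\<rho> (e i (m + n)) = \<rho> (e i m) \<circ> \<rho> (e i n)" for m n
        using hom[OF e_dom[OF i] e_dom[OF i]] by (simp add: e_add)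
      show "surj (F i)" using F[OF i] by (auto simp: formal_diff_iff bij_is_surj)
    qed
    \<comment> \<open>After i flows exactly the first i integer coordinates have been
      inserted.\<close>
    have "C i A = \<rho> ((\<lambda>j. if j < i then a j else 0), b)" if "i \<le> p" for i
      using that
    proof (induction i)
      case 0
      then show ?case by (simp add: C_def wA)
    next
      case (Suc i)
      let ?y = "((\<lambda>j. if j < i then a j else 0), b)"
      have "?y \<in> ZR_dom p q" using ab(2,3) by (auto simp: ZR_dom_def)
      moreover have "ZR_add (e i (a i)) ?y = ((\<lambda>j. if j < Suc i then a j else 0), b)"
        by (auto simp: ZR_add_def e_def less_Suc_eq)
      moreover have "C (Suc i) A = \<rho> (e i (a i)) \<circ> C i A"
        using Suc.prems by (simp only: C_Suc RA Suc_le_eq)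
      ultimately show ?case using Suc hom[OF e_dom, of i ?y "a i"] by simp
    qed
    moreover have "(\<lambda>j. if j < p then a j else 0) = a" using ab(2) by auto
    ultimately have "C p A = \<rho> x" by (simp add: ab(1))
    then show ?thesis using \<open>A \<in> G\<close> by (metis imageI)
  qed

  have "abelian_linear_algebraic_group N G"
    unfolding N_def G_def by (rule abelian_linear_algebraic_group_tvg) (simp add: m_def)
  moreover have "lie_hom_mat N G (C p)"
    unfolding lie_hom_mat_def using C_fd C_hom C_cont by (auto intro: mat_continuous_onI)
  ultimately show ?thesis using C_image by blast
qed

end
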